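(* There is an absolute constant $c>0$ such that the following holds for every field $K$ of characteristic zero. Let $\mathcal{P}$ be a finite set of points in $K^2$, and let $\mathcal{L}$ be the set of lines in $K^2$ that contain at least two points of $\mathcal{P}$. Then at least one of the following is true: (1) there exists a line in $\mathcal{L}$ that contains at least $c|\mathcal{P}|$ points of $\mathcal{P}$; (2) $|\mathcal{L}|\ge c|\mathcal{P}|^2$.
   Context: A line in $K^2$ is a set of the form $\{(x,y)\in K^2: ax+by+c_0=0\}$ with $a,b,c_0\in K$ and $(a,b)\neq(0,0)$. $|S|$ denotes the number of elements of a finite set $S$.
   Formalization: The case of a single point, |P| = 1, is excluded: one point spans no line, so (1) fails and (2) would read 0 ≥ c, which is false for every c > 0. *)

theory Defs
  imports Complex_Main "HOL-Algebra.Ring"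
begin

definition char_zero :: "('a, 'm) ring_scheme \<Rightarrow> bool" where
  "char_zero K \<longleftrightarrow> (\<forall>n::nat. 0 < n \<longrightarrow> [n] \<cdot>\<^bsub>K\<^esub> \<one>\<^bsub>K\<^esub> \<noteq> \<zero>\<^bsub>K\<^esub>)"

definition plane :: "('a, 'm) ring_scheme \<Rightarrow> ('a \<times> 'a) set" where
  "plane K = carrier K \<times> carrier K"

definition lines :: "('a, 'm) ring_scheme \<Rightarrow> ('a \<times> 'a) set set" where
  "lines K = {l. \<exists>a\<in>carrier K. \<exists>b\<in>carrier K. \<exists>c\<^sub>0\<in>carrier K.
     (a, b) \<noteq> (\<zero>\<^bsub>K\<^esub>, \<zero>\<^bsub>K\<^esub>) \<and>
     l = {(x, y) \<in> plane K. a \<otimes>\<^bsub>K\<^esub> x \<oplus>\<^bsub>K\<^esub> b \<otimes>\<^bsub>K\<^esub> y \<oplus>\<^bsub>K\<^esub> c\<^sub>0 = \<zero>\<^bsub>K\<^esub>}}"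

definition spanned_lines :: "('a, 'm) ring_scheme \<Rightarrow> ('a \<times> 'a) set \<Rightarrow> ('a \<times> 'a) set set" where
  "spanned_lines K P = {l \<in> lines K. 2 \<le> card (l \<inter> P)}"

definition beck_dichotomy :: "real \<Rightarrow> ('a, 'm) ring_scheme \<Rightarrow> ('a \<times> 'a) set \<Rightarrow> bool" where
  "beck_dichotomy c K P \<longleftrightarrow>
     (\<exists>l\<in>spanned_lines K P. real (card (l \<inter> P)) \<ge> c * real (card P)) \<or>
     real (card (spanned_lines K P)) \<ge> c * (real (card P))\<^sup>2"

(* A single point spans no line, so both alternatives fail for it, whatever c > 0 is. *)
definition beck_for_field :: "real \<Rightarrow> ('a, 'm) ring_scheme \<Rightarrow> bool" where
  "beck_for_field c K \<longleftrightarrow>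
     (\<forall>P. finite P \<longrightarrow> P \<subseteq> plane K \<longrightarrow> card P \<noteq> 1 \<longrightarrow> beck_dichotomy c K P)"

(* HOL cannot quantify over types inside a formula, so in
     "\<exists>c>0. \<forall>K :: 'a ring. field K \<longrightarrow> char_zero K \<longrightarrow> beck_for_field c K"
   the witness c could depend on 'a. A constant common to the fields over all types has to be a
   closed term without type variables. It is chosen here as any c that serves all fields of
   characteristic zero with carrier in nat, i.e. all countable ones up to isomorphism. This does
   not restrict c further: the coordinates of a finite P generate a countable subfield k of K,
   and P spans the same lines over k as over K, up to the points outside P; so a c that serves
   all countable fields serves all fields.
   The definition alone gives neither existence nor positivity of such a c. *)
definition beck_constant :: real where
  "beck_constant = (SOME c. 0 < c \<and>
     (\<forall>K :: nat ring. field K \<longrightarrow> char_zero K \<longrightarrow> beck_for_field c K))"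

end

theory Submission
  imports
    Defs
    "HOL-Algebra.Generated_Fields"
    "HOL-Algebra.Weak_Morphisms"
    "HOL-Analysis.Analysis"
    "HOL-Computational_Algebra.Fundamental_Theorem_Algebra"
begin

text \<open>
  A finitely generated domain of characteristic 0 embeds into the complex numbers, so let
  \<open>P \<subseteq> \<complex>\<^sup>2\<close>. Map every point to the vector of its monomials of bidegree less than \<open>s\<close>, in dimension
  \<open>D = s\<^sup>2\<close>, and pick disjoint \<open>D\<close>-element subsets of \<open>P\<close> that are sent to bases as long as possible.

  If these sets exhaust half of \<open>P\<close>, let \<open>Q\<close> be their union. Forster's argument provides a linear change of
  coordinates after which the normalised vectors \<open>u\<^sub>p\<close> satisfy \<open>\<Sum>\<^sub>q |\<langle>u\<^sub>p, u\<^sub>q\<rangle>|\<^sup>2 \<le> 4 |Q| / D\<close> for each \<open>p\<close>.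
  The points of a line \<open>l\<close> are sent to a space of dimension at most \<open>2s - 1\<close>, which forces
  \<open>\<Sum>\<^sub>p\<^sub>,\<^sub>q\<^sub>\<in>\<^sub>l |\<langle>u\<^sub>p, u\<^sub>q\<rangle>|\<^sup>2\<close> to be of order at least \<open>|l|\<^sup>2 / s\<close>. As \<open>D\<close> is quadratic in \<open>s\<close>, for a large constant
  \<open>s\<close> at most half of the pairs in \<open>Q\<close> lie on lines with many points.

  Otherwise half of \<open>P\<close> lies on an algebraic curve of bounded degree. A line with many points of that half
  is a component of the curve, only boundedly many of those pass through a given point, and unless one of
  them contains a positive proportion of \<open>P\<close> they again account for few pairs.

  In both cases a positive proportion of all pairs lies on lines containing boundedly many points, so
  there are quadratically many lines.
\<close>

section \<open>Linear algebra\<close>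

text \<open>The matrix determinant lemma for \<open>I + x y^T\<close>. By linearity in row
  \<open>k\<close>, passing from \<open>R J\<close> to \<open>R (insert k J)\<close> adds
  \<open>x $ k\<close> times a determinant with \<open>y\<close> in row \<open>k\<close>, and that
  determinant equals \<open>y $ k\<close>.\<close>

lemma det_identity_plus_outer:
  fixes x y :: "'a::field^'n"
  shows "det (\<chi> i j. (if i = j then 1 else 0) + x $ i * y $ j) = 1 + (\<Sum>i\<in>UNIV. x $ i * y $ i)"
proof -
  define R where "R J = (\<chi> i. axis i 1 + (if i \<in> J then x $ i else 0) *s y)" for J :: "'n set"
  have "det (R J) = 1 + (\<Sum>i\<in>J. x $ i * y $ i)" for J
  proof (induction J rule: finite_induct[OF finite])
    case 1
    have "R {} = mat 1"
      by (simp add: R_def vec_eq_iff mat_def axis_def)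
    then show ?case by simp
  next
    case (2 k J)
    define M where "M w = (\<chi> i. if i = k then w else R J $ i)" for w
    have split: "R (insert k J) = (\<chi> i. if i = k then axis k 1 + x $ k *s y else R J $ i)"
      by (auto simp: R_def vec_eq_iff)
    have "det (M (axis k 1)) = det (R J)"
      using 2 by (intro arg_cong[where f=det]) (auto simp: M_def R_def vec_eq_iff)
    moreover have "det (M y) = y $ k"
    proof -
      \<comment> \<open>Row \<open>k\<close> is \<open>y\<close>, so subtracting
        \<open>x $ l\<close> times it from a row \<open>l\<close> in \<open>J\<close> restores the
        unit vector there. Once all rows are cleared, the identity matrix with \<open>y\<close> in
        row \<open>k\<close> remains.\<close>
      define N where "N I = (\<chi> i. if i = k then y else if i \<in> I then axis i 1 else R J $ i)" for I
      have "det (N I) = det (M y)" for I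
      proof (induction I rule: finite_induct[OF finite])
        case 1
        show ?case by (simp add: N_def M_def cong: if_cong)
      next
        case (2 l I)
        show ?case
        proof (cases "l = k")
          case True
          then have "N (insert l I) = N I" by (auto simp: N_def vec_eq_iff)
          with 2 show ?thesis by simp
        next
          case False
          have "det (\<chi> i. if i = l then row l (N I) + (- (if l \<in> J then x $ l else 0)) *s row k (N I)
                  else row i (N I)) = det (N I)"
            by (rule det_row_operation[OF False])
          moreover have "(\<chi> i. if i = l then row l (N I) + (- (if l \<in> J then x $ l else 0)) *s row k (N I)
                  else row i (N I)) = N (insert l I)"
            using False 2(2) by (auto simp: N_def R_def vec_eq_iff row_def)
          ultimately show ?thesis using 2 by simp
        qed
      qed
      then have "det (M y) = det (N UNIV)" by simp
      also have "N UNIV = (\<chi> i. if i = k then \<Sum>i\<in>UNIV. y $ i *s row i (mat 1) else row i (mat 1))"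
        by (auto simp: N_def vec_eq_iff row_def mat_def axis_def if_distrib cong: if_cong)
      also have "det \<dots> = y $ k"
        by (subst cramer_lemma_transpose) simp
      finally show ?thesis .
    qed
    moreover have "det (R (insert k J)) = det (M (axis k 1)) + x $ k * det (M y)"
      unfolding split M_def det_row_add det_row_mul ..
    ultimately show ?case
      using 2 by simp
  qed
  then have "det (R UNIV) = 1 + (\<Sum>i\<in>UNIV. x $ i * y $ i)" .
  moreover have "R UNIV = (\<chi> i j. (if i = j then 1 else 0) + x $ i * y $ j)"
    by (simp add: R_def vec_eq_iff axis_def)
  ultimately show ?thesis by (simp only:)
qed

text \<open>A maximal independent \<open>B\<close> in \<open>S\<close> decides. Without an
  annihilator, every family covering \<open>B\<close> has nonzero determinant, since a kernel vector
  would annihilate \<open>span B\<close> and hence \<open>S\<close>.\<close>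

lemma det_nonzero_or_annihilator:
  fixes S :: "('a::field^'n) set"
  shows "(\<exists>g. range g \<subseteq> S \<and> det (\<chi> i. g i) \<noteq> 0) \<or> (\<exists>c. c \<noteq> 0 \<and> (\<forall>v\<in>S. (\<Sum>i\<in>UNIV. v $ i * c $ i) = 0))"
proof (rule disjCI)
  assume no: "\<not> (\<exists>c. c \<noteq> 0 \<and> (\<forall>v\<in>S. (\<Sum>i\<in>UNIV. v $ i * c $ i) = 0))"
  obtain B where B: "B \<subseteq> S" "vec.independent B" "S \<subseteq> vec.span B"
    using vec.maximal_independent_subset by blast
  have fin: "finite B" using B(2) vec.finiteI_independent by blast
  have le: "card B \<le> CARD('n)"
    using vec.independent_card_le_dim[OF subset_UNIV B(2)] dim_subset_UNIV_cart_gen le_trans by blast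
  have key: "det (\<chi> i. g i) \<noteq> 0" if g: "B \<subseteq> range g" for g :: "'n \<Rightarrow> 'a^'n"
  proof
    assume "det (\<chi> i. g i) = 0"
    then obtain c where c: "c \<noteq> 0" "(\<chi> i. g i) *v c = 0"
      by (metis invertible_det_nz invertible_left_inverse matrix_left_invertible_ker)
    have "vec.subspace {v. (\<Sum>i\<in>UNIV. v $ i * c $ i) = 0}"
      by (auto simp: vec.subspace_def algebra_simps sum.distrib simp flip: sum_distrib_left)
    moreover have "B \<subseteq> {v. (\<Sum>i\<in>UNIV. v $ i * c $ i) = 0}"
    proof
      fix b assume "b \<in> B"
      then obtain i where "b = g i" using g by blast
      then show "b \<in> {v. (\<Sum>i\<in>UNIV. v $ i * c $ i) = 0}"
        using arg_cong[OF c(2), of "\<lambda>v. v $ i"] by (simp add: matrix_vector_mult_def)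
    qed
    ultimately have "vec.span B \<subseteq> {v. (\<Sum>i\<in>UNIV. v $ i * c $ i) = 0}"
      by (rule vec.span_minimal[rotated])
    with B(3) c(1) no show False by blast
  qed
  have "card B = CARD('n)"
  proof (rule ccontr)
    assume "card B \<noteq> CARD('n)"
    \<comment> \<open>If \<open>B\<close> is too small, there is room for the zero vector as well: a
      family covering \<open>B\<close> with a zero row contradicts \<open>key\<close>.\<close>
    then have "card (insert 0 B) \<le> CARD('n)" 
      using le fin by (simp add: card_insert_if)
    then obtain f :: "'a^'n \<Rightarrow> 'n" where f: "inj_on f (insert 0 B)"
      using fin by (metis card_le_inj finite_insert finite_class.finite_UNIV)
    define g where "g i = (if i \<in> f ` insert 0 B then inv_into (insert 0 B) f i else 0)" for i
    have g: "g (f b) = b" if "b \<in> insert 0 B" for b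
    proof -
      have "f b \<in> f ` insert 0 B" using that by blast
      then show ?thesis
        unfolding g_def using inv_into_f_f[OF f that] by presburger
    qed
    have "B \<subseteq> range g"
      using g by (metis insert_iff rangeI subsetI)
    then have "det (\<chi> i. g i) \<noteq> 0" by (rule key)
    moreover have "row (f 0) (\<chi> i. g i) = 0"
      using g[of 0] by (simp add: row_def vec_eq_iff)
    then have "det (\<chi> i. g i) = 0" by (rule det_zero_row)
    ultimately show False by simp
  qed
  then obtain f where f: "bij_betw f (UNIV :: 'n set) B"
    using fin by (metis finite_same_card_bij finite_class.finite_UNIV)
  then have "range f = B" by (simp add: bij_betw_def)
  with key[of f] B(1) show "\<exists>g. range g \<subseteq> S \<and> det (\<chi> i. g i) \<noteq> 0" by blast
qed

text \<open>A crude form of Hadamard's inequality: each entry in the Leibniz formula is at most the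
  norm of its row. The factorial is harmless, as \<open>balanced\<close> asks only for some positive
  constant.\<close>

lemma norm_det_le_prod_rows:
  fixes A :: "complex^'n^'n"
  shows "norm (det A) \<le> fact CARD('n) * (\<Prod>i\<in>UNIV. norm (A $ i))"
proof -
  have "norm (det A) \<le> (\<Sum>p | p permutes (UNIV::'n set). norm (of_int (sign p) * (\<Prod>i\<in>UNIV. A $ i $ p i)))"
    unfolding det_def by (rule norm_sum)
  also have "\<dots> \<le> (\<Sum>p | p permutes (UNIV::'n set). \<Prod>i\<in>UNIV. norm (A $ i))"
  proof (rule sum_mono)
    fix p :: "'n \<Rightarrow> 'n"
    have "norm (of_int (sign p) * (\<Prod>i\<in>UNIV. A $ i $ p i)) = (\<Prod>i\<in>UNIV. norm (A $ i $ p i))"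
      by (simp add: norm_mult prod_norm sign_def)
    also have "\<dots> \<le> (\<Prod>i\<in>UNIV. norm (A $ i))"
      by (intro prod_mono conjI norm_ge_zero Finite_Cartesian_Product.norm_nth_le)
    finally show "norm (of_int (sign p) * (\<Prod>i\<in>UNIV. A $ i $ p i)) \<le> (\<Prod>i\<in>UNIV. norm (A $ i))" .
  qed
  also have "\<dots> = fact CARD('n) * (\<Prod>i\<in>UNIV. norm (A $ i))"
    by (simp add: card_permutations)
  finally show ?thesis .
qed

text \<open>The operator \<open>\<Sum>i. u i (u i)\<^sup>T\<close> has trace \<open>card I\<close>, rank at most \<open>card B\<close>, and squared Frobenius
  norm equal to the double sum.\<close>

lemma card_squared_le_sum_inner_squared:
  fixes u :: "'i \<Rightarrow> 'a::euclidean_space"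
  assumes "finite I" "finite B"
    and u: "\<And>i. i \<in> I \<Longrightarrow> norm (u i) = 1" "\<And>i. i \<in> I \<Longrightarrow> u i \<in> span B"
  shows "(real (card I))\<^sup>2 \<le> real (card B) * (\<Sum>i\<in>I. \<Sum>j\<in>I. (u i \<bullet> u j)\<^sup>2)"
proof -
  obtain F where F: "pairwise orthogonal F" "\<And>x. x \<in> F \<Longrightarrow> norm x = 1" "independent F"
    "card F = dim (span B)" "span F = span B"
    using orthonormal_basis_subspace[OF subspace_span] by metis
  have fin: "finite F" using F(3) independent_imp_finite by blast
  have "card F \<le> card B"
    using F(4) assms(2) by (simp add: dim_le_card')
  have ip: "u i \<bullet> u j = (\<Sum>f\<in>F. (u i \<bullet> f) * (u j \<bullet> f))" if "i \<in> I" "j \<in> I" for i j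
  proof -
    have "u i = (\<Sum>f\<in>F. (u i \<bullet> f) *\<^sub>R f)"
      using orthonormal_basis_expand[OF F(1,2) _ fin] u(2)[OF that(1)] F(5) by simp
    then have "u i \<bullet> u j = (\<Sum>f\<in>F. (u i \<bullet> f) *\<^sub>R f) \<bullet> u j" by (rule arg_cong)
    also have "\<dots> = (\<Sum>f\<in>F. (u i \<bullet> f) * (f \<bullet> u j))" by (simp add: inner_sum_left)
    finally show ?thesis by (simp add: inner_commute)
  qed
  have "real (card I) = (\<Sum>i\<in>I. u i \<bullet> u i)"
    using u(1) by (simp add: dot_square_norm)
  also have "\<dots> = (\<Sum>i\<in>I. \<Sum>f\<in>F. (u i \<bullet> f)\<^sup>2)"
    by (intro sum.cong refl) (simp add: ip power2_eq_square)
  also have "\<dots> = (\<Sum>f\<in>F. \<Sum>i\<in>I. (u i \<bullet> f)\<^sup>2)" by (rule sum.swap)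
  finally have "(real (card I))\<^sup>2 = (\<Sum>f\<in>F. \<Sum>i\<in>I. (u i \<bullet> f)\<^sup>2)\<^sup>2" by simp
  also have "\<dots> \<le> real (card F) * (\<Sum>f\<in>F. (\<Sum>i\<in>I. (u i \<bullet> f)\<^sup>2)\<^sup>2)"
    using sum_squared_le_sum_of_squares[of "\<lambda>f. \<Sum>i\<in>I. (u i \<bullet> f)\<^sup>2" F] fin by (simp add: mult.commute)
  also have "\<dots> \<le> real (card B) * (\<Sum>f\<in>F. (\<Sum>i\<in>I. (u i \<bullet> f)\<^sup>2)\<^sup>2)"
    using \<open>card F \<le> card B\<close> by (intro mult_right_mono sum_nonneg) auto
  \<comment> \<open>The inner sums are the entries of the operator in the basis \<open>F\<close>.
    Cauchy-Schwarz was applied to its diagonal; here the squares of the off-diagonal entries are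
    added.\<close>
  also have "(\<Sum>f\<in>F. (\<Sum>i\<in>I. (u i \<bullet> f)\<^sup>2)\<^sup>2) \<le> (\<Sum>f\<in>F. \<Sum>g\<in>F. (\<Sum>i\<in>I. (u i \<bullet> f) * (u i \<bullet> g))\<^sup>2)"
  proof (rule sum_mono)
    fix f assume "f \<in> F"
    have "(\<Sum>i\<in>I. (u i \<bullet> f) * (u i \<bullet> f))\<^sup>2 \<le> (\<Sum>g\<in>F. (\<Sum>i\<in>I. (u i \<bullet> f) * (u i \<bullet> g))\<^sup>2)"
      by (rule member_le_sum[OF \<open>f \<in> F\<close> _ fin]) auto
    then show "(\<Sum>i\<in>I. (u i \<bullet> f)\<^sup>2)\<^sup>2 \<le> (\<Sum>g\<in>F. (\<Sum>i\<in>I. (u i \<bullet> f) * (u i \<bullet> g))\<^sup>2)"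
      by (simp add: power2_eq_square)
  qed
  also have "\<dots> = (\<Sum>f\<in>F. \<Sum>g\<in>F. \<Sum>i\<in>I. \<Sum>j\<in>I. ((u i \<bullet> f) * (u j \<bullet> f)) * ((u i \<bullet> g) * (u j \<bullet> g)))"
    by (simp add: power2_eq_square sum_product mult_ac)
  also have "\<dots> = (\<Sum>i\<in>I. \<Sum>j\<in>I. \<Sum>f\<in>F. \<Sum>g\<in>F. ((u i \<bullet> f) * (u j \<bullet> f)) * ((u i \<bullet> g) * (u j \<bullet> g)))"
    by (simp add: sum.swap[of _ F I])
  also have "\<dots> = (\<Sum>i\<in>I. \<Sum>j\<in>I. (u i \<bullet> u j)\<^sup>2)"
    by (intro sum.cong refl) (simp add: ip power2_eq_square sum_product)
  finally show ?thesis by (simp add: mult_left_mono)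
qed

section \<open>Balanced sets of vectors\<close>

definition hermitian :: "complex^'n \<Rightarrow> complex^'n \<Rightarrow> complex" where
  "hermitian x y = (\<Sum>i\<in>UNIV. x $ i * cnj (y $ i))"

lemma hermitian_self: "hermitian x x = of_real ((norm x)\<^sup>2)"
  by (simp add: hermitian_def norm_vec_def L2_set_def sum_nonneg flip: complex_norm_square)

lemma inner_eq_Re_hermitian: "x \<bullet> y = Re (hermitian x y)"
  by (simp add: hermitian_def inner_vec_def inner_complex_def)

lemma hermitian_scaleR_left: "hermitian (c *\<^sub>R x) y = of_real c * hermitian x y"
  by (simp add: hermitian_def scaleR_sum_right flip: scaleR_conv_of_real)

text \<open>For a unit vector \<open>e\<close> this is \<open>I - e e^* / 2\<close>: it halves the
  component along \<open>e\<close> and fixes the orthogonal complement.\<close>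

definition contraction :: "complex^'n \<Rightarrow> complex^'n^'n" where
  "contraction e = (\<chi> i j. (if i = j then 1 else 0) + (- e $ i / 2) * cnj (e $ j))"

lemma det_contraction:
  assumes "norm e = 1"
  shows "det (contraction e) = 1 / 2"
proof -
  have "det (contraction e) = 1 + (\<Sum>i\<in>UNIV. (- e $ i / 2) * cnj (e $ i))"
    using det_identity_plus_outer[of "\<chi> i. - e $ i / 2" "\<chi> i. cnj (e $ i)"]
    by (simp add: contraction_def)
  also have "\<dots> = 1 - hermitian e e / 2"
    by (simp add: hermitian_def sum_negf sum_divide_distrib)
  finally show ?thesis
    using assms by (simp add: hermitian_self)
qed

lemma norm_contraction:
  assumes "norm e = 1"
  shows "(norm (contraction e *v w))\<^sup>2 = (norm w)\<^sup>2 - 3 / 4 * (norm (hermitian w e))\<^sup>2"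
proof -
  define h where "h = hermitian w e"
  have "contraction e *v w = (\<chi> i. w $ i - h / 2 * e $ i)"
  proof (rule vec_eq_iff[THEN iffD2], rule allI)
    fix i
    have "(contraction e *v w) $ i = (\<Sum>j\<in>UNIV. (if i = j then w $ j else 0) - e $ i / 2 * (w $ j * cnj (e $ j)))"
      unfolding contraction_def matrix_vector_mult_def by (auto intro!: sum.cong simp: algebra_simps)
    then show "(contraction e *v w) $ i = (\<chi> i. w $ i - h / 2 * e $ i) $ i"
      by (simp only: sum_subtractf h_def hermitian_def vec_lambda_beta flip: sum_distrib_left) simp
  qed
  moreover have "hermitian (\<chi> i. w $ i - h / 2 * e $ i) (\<chi> i. w $ i - h / 2 * e $ i) =
      hermitian w w - cnj h / 2 * hermitian w e - h / 2 * cnj (hermitian w e) + h * cnj h / 4 * hermitian e e"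
    by (simp add: hermitian_def algebra_simps sum.distrib sum_subtractf sum_distrib_left
        sum_distrib_right sum_divide_distrib)
  ultimately have "complex_of_real ((norm (contraction e *v w))\<^sup>2) =
      of_real ((norm w)\<^sup>2) - 3 / 4 * (h * cnj h)"
    using assms by (simp add: hermitian_self flip: h_def)
  also have "\<dots> = of_real ((norm w)\<^sup>2 - 3 / 4 * (norm h)\<^sup>2)"
    by (simp flip: complex_norm_square)
  finally show ?thesis unfolding h_def by (simp only: of_real_eq_iff)
qed

text \<open>Any disjoint union of \<open>m\<close> subsets that \<open>v\<close> maps to bases is balanced; the estimate says that the
  functional \<open>A \<mapsto> (\<Prod>p\<in>Q. norm (A *v v p)) / norm (det A) ^ m\<close> is bounded away from 0 on
  invertible matrices.\<close>

definition balanced :: "('p \<Rightarrow> complex^'n) \<Rightarrow> 'p set \<Rightarrow> nat \<Rightarrow> bool" where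
  "balanced v Q m \<longleftrightarrow> card Q = m * CARD('n) \<and>
     (\<exists>c>0. \<forall>A :: complex^'n^'n. c * norm (det A) ^ m \<le> (\<Prod>p\<in>Q. norm (A *v v p)))"

lemma balanced_empty: "balanced v {} 0"
  by (auto simp: balanced_def intro!: exI[of _ "1::real"])

text \<open>Hadamard's bound for \<open>V ** transpose A\<close>, whose rows are the vectors
  \<open>A *v v (g i)\<close>, shows that a new basis pays for one more factor
  \<open>norm (det A)\<close>. The nonzero determinant also makes \<open>g\<close> injective, which
  the cardinality needs.\<close>

lemma balanced_Un_basis:
  fixes v :: "'p \<Rightarrow> complex^'n" and g :: "'n \<Rightarrow> 'p"
  assumes Q: "balanced v Q m" "finite Q" and g: "range g \<inter> Q = {}" "det (\<chi> i. v (g i)) \<noteq> 0"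
  shows "balanced v (Q \<union> range g) (Suc m)"
proof -
  have inj: "inj g"
  proof (rule injI, rule ccontr)
    fix i j assume ij: "g i = g j" "i \<noteq> j"
    have "det (\<chi> i. v (g i)) = 0"
      by (rule det_identical_rows[OF ij(2)]) (simp add: row_def ij(1))
    with g(2) show False by simp
  qed
  obtain c where c: "c > 0" "\<And>A :: complex^'n^'n. c * norm (det A) ^ m \<le> (\<Prod>p\<in>Q. norm (A *v v p))"
    using Q(1) by (auto simp: balanced_def)
  define V where "V = (\<chi> i. v (g i))"
  define b where "b = norm (det V) / fact CARD('n)"
  have "b > 0" using g(2) by (simp add: b_def V_def)
  have basis: "b * norm (det A) \<le> (\<Prod>i\<in>UNIV. norm (A *v v (g i)))" for A :: "complex^'n^'n"
  proof -
    have "norm (det V) * norm (det A) = norm (det (V ** transpose A))"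
      by (simp add: det_mul norm_mult)
    also have "\<dots> \<le> fact CARD('n) * (\<Prod>i\<in>UNIV. norm ((V ** transpose A) $ i))"
      by (rule norm_det_le_prod_rows)
    also have "(\<lambda>i. (V ** transpose A) $ i) = (\<lambda>i. A *v v (g i))"
      by (simp add: fun_eq_iff vec_eq_iff matrix_matrix_mult_def matrix_vector_mult_def
          transpose_def V_def mult.commute)
    finally show ?thesis by (simp add: b_def field_simps)
  qed
  have "(c * b) * norm (det A) ^ Suc m \<le> (\<Prod>p\<in>Q \<union> range g. norm (A *v v p))" for A :: "complex^'n^'n"
  proof -
    have "(c * b) * norm (det A) ^ Suc m = (c * norm (det A) ^ m) * (b * norm (det A))"
      by simp
    also have "\<dots> \<le> (\<Prod>p\<in>Q. norm (A *v v p)) * (\<Prod>i\<in>UNIV. norm (A *v v (g i)))"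
      using c \<open>b > 0\<close> by (intro mult_mono basis c(2) prod_nonneg mult_nonneg_nonneg) auto
    also have "(\<Prod>i\<in>UNIV. norm (A *v v (g i))) = (\<Prod>p\<in>range g. norm (A *v v p))"
      by (simp add: prod.reindex[OF inj])
    also have "(\<Prod>p\<in>Q. norm (A *v v p)) * \<dots> = (\<Prod>p\<in>Q \<union> range g. norm (A *v v p))"
      using g(1) Q(2) by (subst prod.union_disjoint) auto
    finally show ?thesis .
  qed
  moreover have "card (Q \<union> range g) = Suc m * CARD('n)"
    using g(1) Q card_image[OF inj] by (subst card_Un_disjoint) (auto simp: balanced_def)
  ultimately show ?thesis
    unfolding balanced_def using c(1) \<open>b > 0\<close> by (intro conjI exI[of _ "c * b"]) auto
qed

text \<open>Take \<open>Q\<close> maximal. A basis among the remaining vectors could be added to it,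
  so they have a common annihilator \<open>c\<close>; for monomial vectors this is the equation of a
  curve through \<open>P - Q\<close>.\<close>

lemma exists_balanced_subset:
  fixes v :: "'p \<Rightarrow> complex^'n"
  assumes "finite P"
  obtains Q m c where "Q \<subseteq> P" "balanced v Q m" "c \<noteq> 0" "\<And>p. p \<in> P - Q \<Longrightarrow> (\<Sum>i\<in>UNIV. v p $ i * c $ i) = 0"
proof -
  define F where "F = {Q. Q \<subseteq> P \<and> (\<exists>m. balanced v Q m)}"
  have "finite F" using assms by (simp add: F_def)
  moreover have "{} \<in> F" using balanced_empty by (auto simp: F_def)
  ultimately obtain Q where Q: "Q \<in> F" and max: "\<And>Q'. Q' \<in> F \<Longrightarrow> Q \<subseteq> Q' \<Longrightarrow> Q' = Q"
    by (metis finite_has_maximal2)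
  from Q obtain m where m: "Q \<subseteq> P" "balanced v Q m" by (auto simp: F_def)
  have "\<not> (\<exists>g. range g \<subseteq> v ` (P - Q) \<and> det (\<chi> i. g i) \<noteq> 0)"
  proof
    assume "\<exists>g. range g \<subseteq> v ` (P - Q) \<and> det (\<chi> i. g i) \<noteq> 0"
    then obtain g where g: "range g \<subseteq> v ` (P - Q)" "det (\<chi> i. g i) \<noteq> 0" by blast
    then have "\<forall>i. \<exists>p\<in>P - Q. g i = v p" by blast
    then obtain f where f: "\<And>i. f i \<in> P - Q" "\<And>i. g i = v (f i)" by metis
    have "balanced v (Q \<union> range f) (Suc m)"
      using m f g(2) finite_subset[OF m(1) assms] by (intro balanced_Un_basis) auto
    with f(1) m(1) have "Q \<union> range f \<in> F" by (auto simp: F_def)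
    from max[OF this] f(1) show False by blast
  qed
  with det_nonzero_or_annihilator[of "v ` (P - Q)"] m that show ?thesis by (auto simp: F_def)
qed

text \<open>Take \<open>A\<close> close to the infimum of that functional. Composing \<open>A\<close> with \<^term>\<open>contraction e\<close> divides the
  determinant by 2, so it cannot shrink too many of the vectors \<open>A *v v q\<close>.\<close>

lemma balanced_position:
  fixes v :: "'p \<Rightarrow> complex^'n"
  assumes "balanced v Q m" "finite Q"
  shows "\<exists>A. det A \<noteq> 0 \<and> (\<forall>q\<in>Q. A *v v q \<noteq> 0) \<and>
    (\<forall>e. norm e = 1 \<longrightarrow> (\<Sum>q\<in>Q. (norm (hermitian (sgn (A *v v q)) e))\<^sup>2) \<le> 4 * real m)"
proof -
  obtain c where c: "c > 0" "\<And>A :: complex^'n^'n. c * norm (det A) ^ m \<le> (\<Prod>p\<in>Q. norm (A *v v p))"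
    using assms by (auto simp: balanced_def)
  define F where "F A = (\<Prod>p\<in>Q. norm (A *v v p)) / norm (det A) ^ m" for A
  define S where "S = F ` {A. det A \<noteq> 0}"
  have lower: "c \<le> F A" if "det A \<noteq> 0" for A
    using c(2)[of A] that by (simp add: F_def field_simps)
  have "S \<noteq> {}" by (auto simp: S_def intro!: exI[of _ "mat 1"])
  have bdd: "bdd_below S" using lower by (auto simp: S_def bdd_below_def)
  have "c \<le> Inf S" using \<open>S \<noteq> {}\<close> lower by (intro cInf_greatest) (auto simp: S_def)
  with c(1) have pos: "Inf S > 0" by simp
  \<comment> \<open>A near-minimiser is enough. The factor is chosen with
    \<open>(4/3)^2 = 16/9 < 2\<close> for the comparison at the end.\<close>
  then have "Inf S < 4 / 3 * Inf S" by simp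
  from cInf_lessD[OF \<open>S \<noteq> {}\<close> this] obtain A where A: "det A \<noteq> 0" "F A < 4 / 3 * Inf S"
    unfolding S_def by blast
  have "(\<Prod>p\<in>Q. norm (A *v v p)) > 0"
    using c(1) c(2)[of A] A(1) by (smt (verit) mult_pos_pos zero_less_norm_iff zero_less_power)
  then have nz: "A *v v q \<noteq> 0" if "q \<in> Q" for q
    using that assms(2) prod_zero_iff[of Q "\<lambda>p. norm (A *v v p)"] by (metis less_irrefl norm_zero)
  define u where "u q = sgn (A *v v q)" for q
  have "(\<Sum>q\<in>Q. (norm (hermitian (u q) e))\<^sup>2) \<le> 4 * real m" if e: "norm e = 1" for e
  proof (rule ccontr)
    let ?s = "\<Sum>q\<in>Q. (norm (hermitian (u q) e))\<^sup>2"
    assume neg: "\<not> ?s \<le> 4 * real m"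
    then have "Q \<noteq> {}" by auto
    then have "m \<noteq> 0" using assms by (auto simp: balanced_def)
    have step: "(norm (contraction e *v (A *v v q)))\<^sup>2 =
        (norm (A *v v q))\<^sup>2 * (1 - 3 / 4 * (norm (hermitian (u q) e))\<^sup>2)" if "q \<in> Q" for q
      using nz[OF that]
      by (simp add: norm_contraction[OF e] u_def sgn_div_norm hermitian_scaleR_left norm_mult norm_divide norm_inverse power_divide power_inverse field_simps)
    have "det (contraction e ** A) \<noteq> 0"
      using A(1) by (simp add: det_mul det_contraction[OF e])
    then have "Inf S \<le> F (contraction e ** A)"
      by (intro cInf_lower bdd) (auto simp: S_def)
    also have "\<dots> = 2 ^ m * (\<Prod>q\<in>Q. norm (contraction e *v (A *v v q))) / norm (det A) ^ m"
      by (simp add: F_def det_mul det_contraction[OF e] norm_mult matrix_vector_mul_assoc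
          norm_divide power_divide power_mult_distrib)
    finally have "F A < 4 / 3 * (2 ^ m * (\<Prod>q\<in>Q. norm (contraction e *v (A *v v q))) / norm (det A) ^ m)"
      using A(2) by linarith
    then have "(\<Prod>q\<in>Q. norm (A *v v q)) < 4 / 3 * 2 ^ m * (\<Prod>q\<in>Q. norm (contraction e *v (A *v v q)))"
      using A(1) by (simp add: F_def field_simps)
    then have "(\<Prod>q\<in>Q. norm (A *v v q))\<^sup>2 < (4 / 3 * 2 ^ m * (\<Prod>q\<in>Q. norm (contraction e *v (A *v v q))))\<^sup>2"
      by (intro power_strict_mono prod_nonneg) auto
    also have "\<dots> = 16 / 9 * 4 ^ m * (\<Prod>q\<in>Q. (norm (contraction e *v (A *v v q)))\<^sup>2)"
      by (simp add: power_mult_distrib power_divide prod_power_distrib flip: power_mult)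
         (simp add: power_mult mult.commute[of m])
    also have "(\<Prod>q\<in>Q. (norm (contraction e *v (A *v v q)))\<^sup>2) =
        (\<Prod>q\<in>Q. norm (A *v v q))\<^sup>2 * (\<Prod>q\<in>Q. 1 - 3 / 4 * (norm (hermitian (u q) e))\<^sup>2)"
      by (simp add: step prod.distrib prod_power_distrib cong: prod.cong)
    finally have "1 < 16 / 9 * 4 ^ m * (\<Prod>q\<in>Q. 1 - 3 / 4 * (norm (hermitian (u q) e))\<^sup>2)"
      using \<open>(\<Prod>p\<in>Q. norm (A *v v p)) > 0\<close> by (simp add: field_simps)
    \<comment> \<open>The bound \<open>1 - x \<le> exp (- x)\<close> turns the product into an
      exponential of the sum, which exceeds \<open>4 * m\<close> by assumption.\<close>
    also have "(\<Prod>q\<in>Q. 1 - 3 / 4 * (norm (hermitian (u q) e))\<^sup>2) \<le>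
        (\<Prod>q\<in>Q. exp (- (3 / 4 * (norm (hermitian (u q) e))\<^sup>2)))"
    proof (intro prod_mono conjI)
      fix q assume q: "q \<in> Q"
      have "0 \<le> (norm (A *v v q))\<^sup>2 * (1 - 3 / 4 * (norm (hermitian (u q) e))\<^sup>2)"
        using step[OF q] by (metis zero_le_power2)
      then show "0 \<le> 1 - 3 / 4 * (norm (hermitian (u q) e))\<^sup>2"
        using nz[OF q] by (simp add: zero_le_mult_iff)
      show "1 - 3 / 4 * (norm (hermitian (u q) e))\<^sup>2 \<le> exp (- (3 / 4 * (norm (hermitian (u q) e))\<^sup>2))"
        using exp_ge_add_one_self[of "- (3 / 4 * (norm (hermitian (u q) e))\<^sup>2)"] by simp
    qed
    also have "\<dots> = exp (- (3 / 4 * ?s))"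
      using assms(2) by (simp add: sum_negf sum_distrib_left flip: exp_sum)
    also have "\<dots> \<le> exp (- 3 * real m)"
      using neg by simp
    finally have "1 < 16 / 9 * 4 ^ m * exp (- 3 * real m)"
      by simp
    then have "exp (3 * real m) < 16 / 9 * 4 ^ m"
      by (simp add: exp_minus field_simps)
    \<comment> \<open>From \<open>exp 1 \<ge> 2\<close> follows \<open>exp 3 \<ge> 8\<close>. As
      \<open>m \<noteq> 0\<close>, \<open>8^m = 2^m * 4^m\<close> is at least
      \<open>2 * 4^m\<close>, which exceeds \<open>16/9 * 4^m\<close>.\<close>
    moreover have "(8::real) ^ m \<le> exp (3 * real m)"
    proof -
      have "(2::real) ^ 3 \<le> exp 1 ^ 3"
        using exp_ge_add_one_self[of "1::real"] by (intro power_mono) auto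
      then have "(8::real) \<le> exp 3"
        by (simp flip: exp_of_nat_mult)
      then have "(8::real) ^ m \<le> exp 3 ^ m" by (intro power_mono) auto
      then show ?thesis by (simp add: mult.commute flip: exp_of_nat_mult)
    qed
    moreover have "(8::real) ^ m = 2 ^ m * 4 ^ m" by (simp flip: power_mult_distrib)
    moreover have "(2::real) ^ m \<ge> 2 ^ 1"
      using \<open>m \<noteq> 0\<close> by (intro power_increasing) auto
    then have "2 * (4::real) ^ m \<le> 2 ^ m * 4 ^ m"
      by (intro mult_right_mono) auto
    moreover have "(4::real) ^ m > 0" by simp
    ultimately show False by linarith
  qed
  with A(1) nz show ?thesis unfolding u_def by blast
qed

section \<open>Pairs of points on rich and poor lines\<close>

text \<open>A polynomial identity without division, so that collinearity carries over along
  isomorphisms of subrings.\<close>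

definition aligned :: "'a::field \<times> 'a \<Rightarrow> 'a \<times> 'a \<Rightarrow> 'a \<times> 'a \<Rightarrow> bool" where
  "aligned p q r \<longleftrightarrow> (fst q - fst p) * (snd r - snd p) = (fst r - fst p) * (snd q - snd p)"

definition point_on :: "'a::field \<times> 'a \<Rightarrow> 'a \<times> 'a \<Rightarrow> 'a \<Rightarrow> 'a \<times> 'a" where
  "point_on p d t = (fst p + t * fst d, snd p + t * snd d)"

definition line_trace :: "('a::field \<times> 'a) set \<Rightarrow> 'a \<times> 'a \<Rightarrow> 'a \<times> 'a \<Rightarrow> ('a \<times> 'a) set" where
  "line_trace P p q = {r \<in> P. aligned p q r}"

text \<open>Stand-ins for the lines spanned by \<open>P\<close>: such a line is determined by the
  points of \<open>P\<close> on it, so lines are counted as subsets of \<open>P\<close>.\<close>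

definition traces :: "('a::field \<times> 'a) set \<Rightarrow> ('a \<times> 'a) set set" where
  "traces P = {line_trace P p q | p q. p \<in> P \<and> q \<in> P \<and> p \<noteq> q}"

definition rich_pairs :: "nat \<Rightarrow> ('a::field \<times> 'a) set \<Rightarrow> (('a \<times> 'a) \<times> ('a \<times> 'a)) set" where
  "rich_pairs M Q = {(p, q) \<in> Q \<times> Q. p \<noteq> q \<and> M < card (line_trace Q p q)}"

definition poor_pairs :: "nat \<Rightarrow> ('a::field \<times> 'a) set \<Rightarrow> (('a \<times> 'a) \<times> ('a \<times> 'a)) set" where
  "poor_pairs M Q = {(p, q) \<in> Q \<times> Q. p \<noteq> q \<and> card (line_trace Q p q) \<le> M}"

lemma aligned_iff_point_on:
  assumes "p \<noteq> q"
  shows "aligned p q r \<longleftrightarrow> (\<exists>t. r = point_on p (q - p) t)"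
proof
  assume a: "aligned p q r"
  show "\<exists>t. r = point_on p (q - p) t"
  proof (cases "fst q = fst p")
    case True
    with assms have "snd q \<noteq> snd p" by (auto simp: prod_eq_iff)
    with a True show ?thesis
      by (intro exI[of _ "(snd r - snd p) / (snd q - snd p)"]) (auto simp: aligned_def point_on_def prod_eq_iff)
  next
    case False
    with a show ?thesis
      by (intro exI[of _ "(fst r - fst p) / (fst q - fst p)"])
         (auto simp: aligned_def point_on_def prod_eq_iff field_simps)
  qed
qed (auto simp: aligned_def point_on_def algebra_simps)

text \<open>Replacing \<open>p\<close> and \<open>q\<close> by the points with parameters
  \<open>s\<close> and \<open>t\<close> on their line multiplies the cross product by
  \<open>t - s\<close>.\<close>

lemma aligned_cong:
  assumes "p \<noteq> q" "a \<noteq> b" "aligned p q a" "aligned p q b"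
  shows "aligned a b r \<longleftrightarrow> aligned p q r"
proof -
  obtain s t where a: "a = point_on p (q - p) s" and b: "b = point_on p (q - p) t"
    using assms aligned_iff_point_on by metis
  have "s \<noteq> t" using assms(2) a b by auto
  have "(fst b - fst a) * (snd r - snd a) - (fst r - fst a) * (snd b - snd a) =
      (t - s) * ((fst q - fst p) * (snd r - snd p) - (fst r - fst p) * (snd q - snd p))"
    unfolding a b point_on_def by (simp add: algebra_simps)
  then show ?thesis
    using \<open>s \<noteq> t\<close> unfolding aligned_def by (metis eq_iff_diff_eq_0 mult_eq_0_iff)
qed

lemma aligned_refl [simp]: "aligned p q p" "aligned p q q"
  by (auto simp: aligned_def)

lemma line_trace_cong:
  assumes "p \<noteq> q" "a \<noteq> b" "a \<in> line_trace P p q" "b \<in> line_trace P p q"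
  shows "line_trace P a b = line_trace P p q"
  using assms aligned_cong[of p q a b] by (auto simp: line_trace_def)

lemma line_trace_in_traces: "p \<in> P \<Longrightarrow> q \<in> P \<Longrightarrow> p \<noteq> q \<Longrightarrow> line_trace P p q \<in> traces P"
  unfolding traces_def by blast

lemma finite_traces: "finite P \<Longrightarrow> finite (traces P)"
  by (rule finite_subset[of _ "Pow P"]) (auto simp: traces_def line_trace_def)

lemma finite_rich_pairs: "finite Q \<Longrightarrow> finite (rich_pairs M Q)"
  by (rule finite_subset[of _ "Q \<times> Q"]) (auto simp: rich_pairs_def)

lemma finite_poor_pairs: "finite Q \<Longrightarrow> finite (poor_pairs M Q)"
  by (rule finite_subset[of _ "Q \<times> Q"]) (auto simp: poor_pairs_def)

lemma card_rich_plus_poor: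
  assumes "finite Q"
  shows "card (rich_pairs M Q) + card (poor_pairs M Q) + card Q = (card Q)\<^sup>2"
proof -
  have "card (rich_pairs M Q) + card (poor_pairs M Q) = card (rich_pairs M Q \<union> poor_pairs M Q)"
    using assms by (intro card_Un_disjoint[symmetric] finite_rich_pairs finite_poor_pairs)
      (auto simp: rich_pairs_def poor_pairs_def)
  moreover have "card Q = card ((\<lambda>p. (p, p)) ` Q)"
    by (simp add: card_image inj_on_def)
  moreover have "card (rich_pairs M Q \<union> poor_pairs M Q) + card ((\<lambda>p. (p, p)) ` Q) = card (rich_pairs M Q \<union> poor_pairs M Q \<union> (\<lambda>p. (p, p)) ` Q)"
    using assms by (intro card_Un_disjoint[symmetric] finite_UnI finite_rich_pairs finite_poor_pairs finite_imageI)
      (auto simp: rich_pairs_def poor_pairs_def)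
  moreover have "rich_pairs M Q \<union> poor_pairs M Q \<union> (\<lambda>p. (p, p)) ` Q = Q \<times> Q"
    by (auto simp: rich_pairs_def poor_pairs_def)
  ultimately show ?thesis by (simp add: card_cartesian_product power2_eq_square)
qed

text \<open>Group the pairs by their trace on \<open>P\<close>. A trace that carries a poor pair has
  at most \<open>M\<close> points in \<open>Q\<close>, hence at most \<open>M^2\<close>
  pairs.\<close>

lemma card_poor_pairs_le:
  assumes "finite P" "Q \<subseteq> P"
  shows "card (poor_pairs M Q) \<le> M\<^sup>2 * card (traces P)"
proof -
  define S where "S t = {(p, q) \<in> poor_pairs M Q. line_trace P p q = t}" for t
  have Q: "finite Q" using assms finite_subset by blast
  have fibre: "card (S t) \<le> M\<^sup>2" for t
  proof (cases "S t = {}")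
    case False
    then obtain p q where pq: "(p, q) \<in> poor_pairs M Q" "line_trace P p q = t" by (auto simp: S_def)
    have t: "t \<inter> Q = line_trace Q p q" using assms(2) pq(2) by (auto simp: line_trace_def)
    have "S t \<subseteq> (t \<inter> Q) \<times> (t \<inter> Q)"
      using assms(2) by (auto simp: S_def poor_pairs_def line_trace_def)
    then have "card (S t) \<le> card ((t \<inter> Q) \<times> (t \<inter> Q))"
      using Q by (intro card_mono) auto
    also have "\<dots> = (card (line_trace Q p q))\<^sup>2"
      by (simp add: card_cartesian_product power2_eq_square t)
    also have "\<dots> \<le> M\<^sup>2" using pq(1) by (auto simp: poor_pairs_def)
    finally show ?thesis .
  qed simp
  have "poor_pairs M Q \<subseteq> (\<Union>t\<in>traces P. S t)"
  proof (rule subrelI)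
    fix p q assume pq: "(p, q) \<in> poor_pairs M Q"
    then have "(p, q) \<in> S (line_trace P p q)" by (simp add: S_def)
    moreover have "line_trace P p q \<in> traces P"
      using pq assms(2) by (intro line_trace_in_traces) (auto simp: poor_pairs_def)
    ultimately show "(p, q) \<in> (\<Union>t\<in>traces P. S t)" by (rule UN_I[rotated])
  qed
  moreover have "finite (S t)" for t
    by (rule finite_subset[OF _ finite_poor_pairs[OF Q, of M]]) (auto simp: S_def)
  ultimately have "card (poor_pairs M Q) \<le> card (\<Union>t\<in>traces P. S t)"
    using finite_traces[OF assms(1)] by (intro card_mono) auto
  also have "\<dots> \<le> (\<Sum>t\<in>traces P. card (S t))"
    by (rule card_UN_le[OF finite_traces[OF assms(1)]])
  also have "\<dots> \<le> (\<Sum>t\<in>traces P. M\<^sup>2)" by (intro sum_mono fibre)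
  finally show ?thesis by (simp add: mult.commute)
qed

text \<open>Two distinct points of a trace have that very trace, so rich pairs are the off-diagonal
  pairs of rich traces. The weight \<open>w\<close> covers both the number of pairs and their
  squared inner products.\<close>

lemma sum_rich_pairs:
  fixes w :: "('a::field \<times> 'a) \<times> ('a \<times> 'a) \<Rightarrow> real"
  assumes "finite Q"
  shows "sum w (rich_pairs M Q) =
    (\<Sum>t | t \<in> traces Q \<and> M < card t. \<Sum>pq | pq \<in> t \<times> t \<and> fst pq \<noteq> snd pq. w pq)"
proof -
  let ?T = "{t. t \<in> traces Q \<and> M < card t}"
  have "sum w (rich_pairs M Q) = (\<Sum>t\<in>?T. sum w {pq \<in> rich_pairs M Q. line_trace Q (fst pq) (snd pq) = t})"
  proof (rule sum.group[symmetric])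
    show "finite (rich_pairs M Q)" using assms by (rule finite_rich_pairs)
    show "finite ?T" using finite_traces[OF assms] by simp
    show "(\<lambda>pq. line_trace Q (fst pq) (snd pq)) ` rich_pairs M Q \<subseteq> ?T"
    proof (clarify, intro conjI)
      fix p q assume "(p, q) \<in> rich_pairs M Q"
      then have pq: "p \<in> Q" "q \<in> Q" "p \<noteq> q" "M < card (line_trace Q p q)"
        by (auto simp: rich_pairs_def)
      show "line_trace Q (fst (p, q)) (snd (p, q)) \<in> traces Q"
        using pq by (simp add: line_trace_in_traces)
      show "M < card (line_trace Q (fst (p, q)) (snd (p, q)))" using pq(4) by simp
    qed
  qed
  also have "\<dots> = (\<Sum>t\<in>?T. \<Sum>pq | pq \<in> t \<times> t \<and> fst pq \<noteq> snd pq. w pq)"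
  proof (intro sum.cong refl)
    fix t assume t: "t \<in> ?T"
    then obtain p q where pq: "p \<in> Q" "q \<in> Q" "p \<noteq> q" "t = line_trace Q p q" by (auto simp: traces_def)
    have sub: "t \<subseteq> Q" using pq(4) by (auto simp: line_trace_def)
    have eq: "line_trace Q a b = t \<longleftrightarrow> a \<in> t \<and> b \<in> t" if "a \<in> Q" "b \<in> Q" "a \<noteq> b" for a b
    proof
      assume "line_trace Q a b = t"
      then show "a \<in> t \<and> b \<in> t" using that(1,2) by (auto simp: line_trace_def)
    next
      assume "a \<in> t \<and> b \<in> t"
      then show "line_trace Q a b = t" using line_trace_cong[OF pq(3) that(3)] pq(4) by simp
    qed
    show "{pq \<in> rich_pairs M Q. line_trace Q (fst pq) (snd pq) = t} = {pq. pq \<in> t \<times> t \<and> fst pq \<noteq> snd pq}"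
    proof (rule Set.set_eqI)
      fix x :: "('a \<times> 'a) \<times> ('a \<times> 'a)"
      obtain a b where x: "x = (a, b)" by (rule prod.exhaust)
      have "M < card (line_trace Q a b)" if "line_trace Q a b = t" using t that by simp
      then show "x \<in> {pq \<in> rich_pairs M Q. line_trace Q (fst pq) (snd pq) = t} \<longleftrightarrow>
          x \<in> {pq. pq \<in> t \<times> t \<and> fst pq \<noteq> snd pq}"
        unfolding x rich_pairs_def mem_Collect_eq case_prod_conv mem_Sigma_iff fst_conv snd_conv
        using eq[of a b] sub by blast
    qed
  qed
  finally show ?thesis .
qed

text \<open>On a line with \<open>n > 4 * r\<close> points,
  \<open>card_squared_le_sum_inner_squared\<close> gives \<open>n^2 \<le> 2 * r * (s + n)\<close>,
  where \<open>s\<close> sums over the distinct pairs. The diagonal part \<open>2 * r * n\<close> is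
  at most \<open>n^2 / 2\<close>, so \<open>n^2 \<le> 4 * r * s\<close>.\<close>

lemma card_rich_pairs_le:
  fixes u :: "'a::field \<times> 'a \<Rightarrow> 'b::euclidean_space"
  assumes Q: "finite Q" and r: "r > 0"
    and unit: "\<And>p. p \<in> Q \<Longrightarrow> norm (u p) = 1"
    and span: "\<And>t. t \<in> traces Q \<Longrightarrow> \<exists>B. finite B \<and> card B \<le> 2 * r \<and> u ` t \<subseteq> span B"
  shows "real (card (rich_pairs (4 * r) Q)) \<le> 4 * real r * (\<Sum>p\<in>Q. \<Sum>q\<in>Q. (u p \<bullet> u q)\<^sup>2)"
proof -
  let ?w = "\<lambda>(p, q). (u p \<bullet> u q)\<^sup>2"
  have line: "real (card {pq. pq \<in> t \<times> t \<and> fst pq \<noteq> snd pq}) \<le>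
      4 * real r * (\<Sum>pq | pq \<in> t \<times> t \<and> fst pq \<noteq> snd pq. ?w pq)"
    if t: "t \<in> traces Q" "4 * r < card t" for t
  proof -
    have sub: "t \<subseteq> Q" using t(1) by (auto simp: traces_def line_trace_def)
    then have fin: "finite t" using Q finite_subset by blast
    have split: "t \<times> t = {pq. pq \<in> t \<times> t \<and> fst pq \<noteq> snd pq} \<union> (\<lambda>p. (p, p)) ` t" by auto
    have sum_split: "sum f (t \<times> t) = (\<Sum>pq | pq \<in> t \<times> t \<and> fst pq \<noteq> snd pq. f pq) + (\<Sum>p\<in>t. f (p, p))"
      for f :: "_ \<Rightarrow> real"
    proof -
      have "sum f (t \<times> t) = sum f {pq. pq \<in> t \<times> t \<and> fst pq \<noteq> snd pq} + sum f ((\<lambda>p. (p, p)) ` t)"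
        by (subst split, rule sum.union_disjoint) (use fin in \<open>auto intro: finite_subset[of _ "t \<times> t"]\<close>)
      also have "sum f ((\<lambda>p. (p, p)) ` t) = (\<Sum>p\<in>t. f (p, p))"
        by (subst sum.reindex) (auto simp: inj_on_def)
      finally show ?thesis .
    qed
    obtain B where B: "finite B" "card B \<le> 2 * r" "u ` t \<subseteq> span B" using span[OF t(1)] by blast
    define n where "n = real (card t)"
    have "n\<^sup>2 \<le> real (card B) * (\<Sum>p\<in>t. \<Sum>q\<in>t. (u p \<bullet> u q)\<^sup>2)"
      unfolding n_def using sub unit B(3) by (intro card_squared_le_sum_inner_squared fin B(1)) auto
    also have "\<dots> \<le> (2 * real r) * (\<Sum>p\<in>t. \<Sum>q\<in>t. (u p \<bullet> u q)\<^sup>2)"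
      using B(2) by (intro mult_right_mono sum_nonneg) auto
    also have "(\<Sum>p\<in>t. \<Sum>q\<in>t. (u p \<bullet> u q)\<^sup>2) = sum ?w (t \<times> t)"
      by (simp add: sum.cartesian_product)
    also have "\<dots> = (\<Sum>pq | pq \<in> t \<times> t \<and> fst pq \<noteq> snd pq. ?w pq) + n"
    proof -
      have "?w (p, p) = 1" if "p \<in> t" for p
        using unit[of p] sub that by (simp add: dot_square_norm subsetD)
      then have "(\<Sum>p\<in>t. ?w (p, p)) = n" by (simp add: n_def)
      with sum_split[of ?w] show ?thesis by linarith
    qed
    finally have "n\<^sup>2 \<le> 2 * real r * (\<Sum>pq | pq \<in> t \<times> t \<and> fst pq \<noteq> snd pq. ?w pq) + 2 * real r * n"
      by (simp add: algebra_simps)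
    moreover have "4 * real r * n \<le> n * n"
      using t(2) unfolding n_def by (intro mult_right_mono) (auto simp flip: of_nat_mult)
    moreover have "real (card {pq. pq \<in> t \<times> t \<and> fst pq \<noteq> snd pq}) = n\<^sup>2 - n"
      using sum_split[of "\<lambda>_. 1"] by (simp add: n_def card_cartesian_product power2_eq_square)
    moreover have "n \<ge> 0" by (simp add: n_def)
    ultimately show ?thesis by (simp add: power2_eq_square)
  qed
  have "real (card (rich_pairs (4 * r) Q)) = sum (\<lambda>_. 1) (rich_pairs (4 * r) Q)" by simp
  also have "\<dots> = (\<Sum>t | t \<in> traces Q \<and> 4 * r < card t. real (card {pq. pq \<in> t \<times> t \<and> fst pq \<noteq> snd pq}))"
    by (subst sum_rich_pairs[OF Q]) simp
  also have "\<dots> \<le> (\<Sum>t | t \<in> traces Q \<and> 4 * r < card t. 4 * real r * (\<Sum>pq | pq \<in> t \<times> t \<and> fst pq \<noteq> snd pq. ?w pq))"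
    by (intro sum_mono line) auto
  also have "\<dots> = 4 * real r * sum ?w (rich_pairs (4 * r) Q)"
    by (subst sum_rich_pairs[OF Q]) (simp add: sum_distrib_left)
  also have "\<dots> \<le> 4 * real r * sum ?w (Q \<times> Q)"
    using Q by (intro mult_left_mono sum_mono2) (auto simp: rich_pairs_def)
  finally show ?thesis by (simp add: sum.cartesian_product)
qed

section \<open>Monomial vectors and algebraic curves\<close>

definition veronese :: "('n::finite \<Rightarrow> nat \<times> nat) \<Rightarrow> 'a::comm_semiring_1 \<times> 'a \<Rightarrow> 'a^'n" where
  "veronese e p = (\<chi> i. fst p ^ fst (e i) * snd p ^ snd (e i))"

definition line_poly :: "nat \<times> nat \<Rightarrow> 'a::field \<times> 'a \<Rightarrow> 'a \<times> 'a \<Rightarrow> 'a poly" where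
  "line_poly ab p d = [:fst p, fst d:] ^ fst ab * [:snd p, snd d:] ^ snd ab"

lemma veronese_point_on: "veronese e (point_on p d t) $ i = poly (line_poly (e i) p d) t"
  by (simp add: veronese_def point_on_def line_poly_def)

lemma degree_line_poly: "degree (line_poly ab p d) \<le> fst ab + snd ab"
proof -
  have lin: "degree ([:a, b:] ^ n) \<le> n" for a b :: 'a and n
  proof -
    have "degree [:a, b:] * n \<le> 1 * n" by (intro mult_right_mono) auto
    then show ?thesis using degree_power_le[of "[:a, b:]" n] by linarith
  qed
  show ?thesis
    unfolding line_poly_def by (rule order.trans[OF degree_mult_le add_mono[OF lin lin]])
qed

text \<open>A line becomes a curve parametrised by polynomials of degree at most \<open>k\<close>,
  which lies in the span of its \<open>k + 1\<close> coefficient vectors.\<close>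

lemma veronese_point_on_expand:
  fixes p d :: "'a::field \<times> 'a"
  assumes "\<And>i. fst (e i) + snd (e i) \<le> k"
  shows "veronese e (point_on p d t) = (\<Sum>j\<le>k. t ^ j *s (\<chi> i. coeff (line_poly (e i) p d) j))"
proof -
  have "poly (line_poly (e i) p d) t = (\<Sum>j\<le>k. coeff (line_poly (e i) p d) j * t ^ j)" for i
    using poly_as_sum_of_monoms'[OF order.trans[OF degree_line_poly assms]]
    by (metis (no_types, lifting) poly_monom poly_sum sum.cong)
  then show ?thesis
    by (simp add: vec_eq_iff veronese_point_on mult.commute)
qed

text \<open>Here \<open>span\<close> is taken over the reals, so each of the \<open>k + 1\<close>
  complex directions contributes two vectors, \<open>a j\<close> and
  \<open>\<i> *s a j\<close>.\<close>

lemma veronese_line_in_span: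
  fixes A :: "complex^'n^'n" and e :: "'n \<Rightarrow> nat \<times> nat"
  assumes "\<And>i. fst (e i) + snd (e i) \<le> k"
  obtains B where "finite B" "card B \<le> 2 * Suc k" "\<And>t. A *v veronese e (point_on p d t) \<in> span B"
proof -
  define a where "a j = A *v (\<chi> i. coeff (line_poly (e i) p d) j)" for j
  define B where "B = a ` {..k} \<union> (\<lambda>j. \<i> *s a j) ` {..k}"
  have "card B \<le> card (a ` {..k}) + card ((\<lambda>j. \<i> *s a j) ` {..k})"
    unfolding B_def by (rule card_Un_le)
  also have "\<dots> \<le> Suc k + Suc k"
    by (intro add_mono order.trans[OF card_image_le]) auto
  finally have "card B \<le> 2 * Suc k" by simp
  moreover have "A *v veronese e (point_on p d t) \<in> span B" for t
  proof -
    have "A *v veronese e (point_on p d t) = (\<Sum>j\<le>k. t ^ j *s a j)"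
      unfolding veronese_point_on_expand[OF assms] a_def
      by (simp add: vec.linear_sum[OF matrix_vector_mul_linear_gen] vector_scalar_commute)
    also have "\<dots> = (\<Sum>j\<le>k. Re (t ^ j) *\<^sub>R a j + Im (t ^ j) *\<^sub>R (\<i> *s a j))"
      by (intro sum.cong refl) (simp add: vec_eq_iff complex_eq_iff)
    also have "\<dots> \<in> span B"
      by (intro span_sum span_add span_scale span_base) (auto simp: B_def)
    finally show ?thesis .
  qed
  ultimately show ?thesis using that[of B] by (simp add: B_def)
qed

text \<open>After the change of coordinates from \<open>balanced_position\<close>,
  \<open>card_rich_pairs_le\<close> bounds the rich pairs by
  \<open>16 * Suc k * (card Q * m)\<close>. Multiplying by the dimension turns \<open>m\<close> into
  \<open>card Q\<close>.\<close>

lemma card_rich_pairs_balanced: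
  fixes e :: "'n::finite \<Rightarrow> nat \<times> nat"
  assumes Q: "balanced (veronese e) Q m" "finite Q"
    and e: "\<And>i. fst (e i) + snd (e i) \<le> k"
  shows "card (rich_pairs (4 * Suc k) Q) * CARD('n) \<le> 16 * Suc k * (card Q)\<^sup>2"
proof -
  obtain A :: "complex^'n^'n" where A: "\<forall>q\<in>Q. A *v veronese e q \<noteq> 0"
    "\<forall>x. norm x = 1 \<longrightarrow> (\<Sum>q\<in>Q. (norm (hermitian (sgn (A *v veronese e q)) x))\<^sup>2) \<le> 4 * real m"
    using balanced_position[OF Q] by blast
  define u where "u q = sgn (A *v veronese e q)" for q
  have unit: "norm (u q) = 1" if "q \<in> Q" for q
    using A(1) that by (simp add: u_def norm_sgn)
  have row: "(\<Sum>q\<in>Q. (u p \<bullet> u q)\<^sup>2) \<le> 4 * real m" if "p \<in> Q" for p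
  proof -
    \<comment> \<open>The test vector in the estimate of \<open>balanced_position\<close> is
      \<open>u p\<close> itself; the real inner product is at most the modulus of the Hermitian
      one.\<close>
    have "(\<Sum>q\<in>Q. (u p \<bullet> u q)\<^sup>2) \<le> (\<Sum>q\<in>Q. (norm (hermitian (u q) (u p)))\<^sup>2)"
      by (intro sum_mono) (metis inner_commute inner_eq_Re_hermitian abs_Re_le_cmod abs_le_square_iff abs_norm_cancel)
    also have "\<dots> \<le> 4 * real m"
      using A(2) unit[OF that] by (simp add: u_def)
    finally show ?thesis .
  qed
  have span: "\<exists>B. finite B \<and> card B \<le> 2 * Suc k \<and> u ` t \<subseteq> span B" if t: "t \<in> traces Q" for t
  proof -
    obtain p q where pq: "p \<in> Q" "q \<in> Q" "p \<noteq> q" "t = line_trace Q p q" using t by (auto simp: traces_def)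
    obtain B where B: "finite B" "card B \<le> 2 * Suc k" "\<And>s. A *v veronese e (point_on p (q - p) s) \<in> span B"
      by (rule veronese_line_in_span[OF e]) (rule that; simp)
    have "u r \<in> span B" if "r \<in> t" for r
      using that pq B(3) aligned_iff_point_on[of p q r] unfolding u_def line_trace_def sgn_div_norm
      by (auto intro: span_scale)
    with B show ?thesis by blast
  qed
  have "real (card (rich_pairs (4 * Suc k) Q)) \<le> 4 * real (Suc k) * (\<Sum>p\<in>Q. \<Sum>q\<in>Q. (u p \<bullet> u q)\<^sup>2)"
    by (rule card_rich_pairs_le[OF Q(2) _ unit span]) auto
  also have "\<dots> \<le> 4 * real (Suc k) * (\<Sum>p\<in>Q. 4 * real m)"
    by (intro mult_left_mono sum_mono row) auto
  finally have "real (card (rich_pairs (4 * Suc k) Q)) \<le> real (16 * Suc k * (card Q * m))"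
    by (simp add: mult_ac)
  then have "card (rich_pairs (4 * Suc k) Q) \<le> 16 * Suc k * (card Q * m)"
    by (simp only: of_nat_le_iff)
  then have "card (rich_pairs (4 * Suc k) Q) * CARD('n) \<le> 16 * Suc k * (card Q * m) * CARD('n)"
    by (rule mult_right_mono) simp
  also have "\<dots> = 16 * Suc k * (card Q)\<^sup>2"
    using Q(1) by (simp add: balanced_def power2_eq_square)
  finally show ?thesis .
qed

section \<open>Plane curves and the lines they contain\<close>

definition curve_value :: "('n::finite \<Rightarrow> nat \<times> nat) \<Rightarrow> 'a::field^'n \<Rightarrow> 'a \<times> 'a \<Rightarrow> 'a" where
  "curve_value e c p = (\<Sum>i\<in>UNIV. veronese e p $ i * c $ i)"

text \<open>Restricted to the line, the polynomial has degree at most \<open>k\<close> in the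
  parameter but more than \<open>k\<close> roots.\<close>

lemma curve_value_line_eq_0:
  fixes e :: "'n::finite \<Rightarrow> nat \<times> nat" and p d :: "'a::field \<times> 'a"
  assumes e: "\<And>i. fst (e i) + snd (e i) \<le> k"
    and T: "finite T" "k < card T" "\<And>t. t \<in> T \<Longrightarrow> curve_value e c (point_on p d t) = 0"
  shows "curve_value e c (point_on p d s) = 0"
proof -
  define F where "F = (\<Sum>i\<in>UNIV. smult (c $ i) (line_poly (e i) p d))"
  have F: "poly F t = curve_value e c (point_on p d t)" for t
    by (simp add: F_def curve_value_def veronese_point_on poly_sum mult.commute)
  have "degree F \<le> k"
    unfolding F_def by (intro degree_sum_le order.trans[OF degree_smult_le] order.trans[OF degree_line_poly e]) auto
  have "F = 0"
  proof (rule ccontr)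
    assume "F \<noteq> 0"
    have "card T \<le> card {t. poly F t = 0}"
      using T(3) F poly_roots_finite[OF \<open>F \<noteq> 0\<close>] by (intro card_mono) auto
    also have "\<dots> \<le> degree F" by (rule card_poly_roots_bound[OF \<open>F \<noteq> 0\<close>])
    finally show False using \<open>degree F \<le> k\<close> T(2) by simp
  qed
  with F show ?thesis by (metis poly_0)
qed

text \<open>Uniqueness of coefficients over an infinite field, used twice: for the polynomial in
  \<open>x\<close> at a fixed \<open>y\<close>, then for its coefficients as polynomials in
  \<open>y\<close>.\<close>

lemma curve_value_all_zero:
  fixes c :: "'a::field_char_0^'n::finite"
  assumes e: "bij_betw e UNIV ({..<s} \<times> {..<s})"
    and zero: "\<And>p. curve_value e c p = 0"
  shows "c = 0"
proof -
  define b where "b = the_inv_into UNIV e"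
  have b: "b (e i) = i" for i
    using e by (simp add: b_def bij_betw_def the_inv_into_f_f)
  have sum0: "(\<Sum>a<s. (\<Sum>j<s. c $ b (a, j) * y ^ j) * x ^ a) = 0" for x y
  proof -
    have "0 = curve_value e c (x, y)" using zero by simp
    also have "\<dots> = (\<Sum>i\<in>UNIV. (\<lambda>q. x ^ fst q * y ^ snd q * c $ b q) (e i))"
      by (simp add: curve_value_def veronese_def b)
    also have "\<dots> = (\<Sum>q\<in>{..<s} \<times> {..<s}. x ^ fst q * y ^ snd q * c $ b q)"
      by (rule sum.reindex_bij_betw[OF e])
    also have "\<dots> = (\<Sum>a<s. (\<Sum>j<s. c $ b (a, j) * y ^ j) * x ^ a)"
      by (simp add: sum.cartesian_product' sum_distrib_right sum_distrib_left mult_ac)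
    finally show ?thesis by simp
  qed
  have poly0: "f a = 0" if "\<And>x. (\<Sum>a<s. f a * x ^ a) = 0" "a < s" for f :: "nat \<Rightarrow> 'a" and a
  proof -
    have "(\<Sum>a<s. monom (f a) a) = 0"
      using that(1) by (subst poly_eq_poly_eq_iff[symmetric]) (simp add: fun_eq_iff poly_sum poly_monom)
    then have "coeff (\<Sum>a<s. monom (f a) a) a = 0" by simp
    then show ?thesis using that(2) by (simp add: coeff_sum)
  qed
  have "c $ b (a, j) = 0" if "a < s" "j < s" for a j
    using poly0[OF poly0[OF sum0 that(1)] that(2)] .
  then have "c $ b (e i) = 0" for i
    using bij_betw_apply[OF e, of i] by (metis SigmaE UNIV_I lessThan_iff)
  then show ?thesis by (simp add: b vec_eq_iff)
qed

lemma point_on_0 [simp]: "point_on p d 0 = p"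
  by (simp add: point_on_def)

text \<open>The line through \<open>z\<close> parallel to one of the given lines meets the others in distinct points.\<close>

lemma curve_value_concurrent_lines:
  fixes e :: "'n::finite \<Rightarrow> nat \<times> nat" and p :: "'a::field \<times> 'a"
  assumes e: "\<And>i. fst (e i) + snd (e i) \<le> k"
    and V: "finite V" "Suc k < card V"
    and transversal: "\<And>d d'. d \<in> V \<Longrightarrow> d' \<in> V \<Longrightarrow> d \<noteq> d' \<Longrightarrow> fst d * snd d' \<noteq> fst d' * snd d"
    and zero: "\<And>d t. d \<in> V \<Longrightarrow> curve_value e c (point_on p d t) = 0"
  shows "curve_value e c z = 0"
proof -
  define cross where "cross a b = fst a * snd b - fst b * snd a" for a b :: "'a \<times> 'a"
  obtain d0 where d0: "d0 \<in> V" using V by (metis card.empty ex_in_conv not_less_zero)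
  \<comment> \<open>The direction \<open>d0\<close> is given up to serve as the parallel one; more
    than \<open>k\<close> others remain, which is why the bound on \<open>card V\<close> has
    \<open>Suc k\<close>.\<close>
  have card: "card (V - {d0}) > k" using V d0 by simp
  then obtain d1 where "d1 \<in> V - {d0}" by (metis card.empty ex_in_conv not_less_zero)
  with transversal[of d0 d1] d0 have "d0 \<noteq> (0, 0)" by auto
  show ?thesis
  proof (cases "cross (z - p) d0 = 0")
    case True
    with \<open>d0 \<noteq> (0, 0)\<close> have "aligned p (p + d0) z"
      by (simp add: cross_def aligned_def algebra_simps)
    then obtain t where "z = point_on p d0 t"
      using aligned_iff_point_on[of p "p + d0" z] \<open>d0 \<noteq> (0, 0)\<close> by (auto simp: zero_prod_def)
    with zero[OF d0] show ?thesis by simp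
  next
    case False
    \<comment> \<open>Cramer's rule: \<open>\<tau> d\<close> and \<open>\<sigma> d\<close> are the
      parameters at which the line through \<open>z\<close> in direction \<open>d0\<close> meets the
      line through \<open>p\<close> in direction \<open>d\<close>.\<close>
    define \<tau> where "\<tau> d = - cross (z - p) d / cross d0 d" for d
    define \<sigma> where "\<sigma> d = cross (z - p) d0 / cross d d0" for d
    have nz: "cross d0 d \<noteq> 0" "cross d d0 \<noteq> 0" if "d \<in> V - {d0}" for d
      using transversal[of d0 d] transversal[of d d0] d0 that by (auto simp: cross_def)
    have meet: "point_on z d0 (\<tau> d) = point_on p d (\<sigma> d)" if d: "d \<in> V - {d0}" for d
    proof -
      have cc: "cross d d0 = - cross d0 d" by (simp add: cross_def)
      \<comment> \<open>The linear relation between the three plane vectors \<open>z - p\<close>,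
        \<open>d0\<close> and \<open>d\<close>, in coordinates.\<close>
      have "(fst z - fst p) * cross d0 d - cross (z - p) d * fst d0 + cross (z - p) d0 * fst d = 0"
        "(snd z - snd p) * cross d0 d - cross (z - p) d * snd d0 + cross (z - p) d0 * snd d = 0"
        by (simp_all add: cross_def algebra_simps)
      then show ?thesis
        using nz(1)[OF d] unfolding point_on_def \<tau>_def \<sigma>_def cc
        by (auto simp: field_simps)
    qed
    have inj: "inj_on \<tau> (V - {d0})"
    proof (rule inj_onI, rule ccontr)
      fix d d' assume d: "d \<in> V - {d0}" "d' \<in> V - {d0}" "\<tau> d = \<tau> d'" "d \<noteq> d'"
      then have "point_on p d (\<sigma> d) = point_on p d' (\<sigma> d')" using meet by metis
      then have "\<sigma> d * fst d = \<sigma> d' * fst d'" "\<sigma> d * snd d = \<sigma> d' * snd d'"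
        by (auto simp: point_on_def)
      then have "\<sigma> d * \<sigma> d' * (fst d * snd d' - fst d' * snd d) = 0"
        by (simp add: algebra_simps)
      moreover have "\<sigma> d \<noteq> 0" "\<sigma> d' \<noteq> 0" using False nz d by (auto simp: \<sigma>_def)
      ultimately show False using transversal[of d d'] d by auto
    qed
    have "curve_value e c (point_on z d0 0) = 0"
    proof (rule curve_value_line_eq_0[OF e])
      show "finite (\<tau> ` (V - {d0}))" using V by simp
      show "k < card (\<tau> ` (V - {d0}))" using card by (simp add: card_image[OF inj])
      show "curve_value e c (point_on z d0 t) = 0" if "t \<in> \<tau> ` (V - {d0})" for t
      proof -
        obtain d where "d \<in> V - {d0}" "t = \<tau> d" using \<open>t \<in> _\<close> by blast
        then show ?thesis using meet zero[of d] by simp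
      qed
    qed
    then show ?thesis by simp
  qed
qed

lemma line_trace_eq_point_on:
  "p \<noteq> q \<Longrightarrow> line_trace R p q = point_on p (q - p) ` {t. point_on p (q - p) t \<in> R}"
  using aligned_iff_point_on[of p q] by (auto simp: line_trace_def)

lemma inj_point_on: "d \<noteq> 0 \<Longrightarrow> inj (point_on p d)"
  by (auto simp: inj_def point_on_def prod_eq_iff)

text \<open>A line with more than \<open>M \<ge> k\<close> points of \<open>R\<close> lies on the
  curve. More than \<open>k + 1\<close> such lines through \<open>p\<close> would make the
  polynomial vanish everywhere, against \<open>c \<noteq> 0\<close>.\<close>

lemma card_rich_lines_through_point:
  fixes e :: "'n::finite \<Rightarrow> nat \<times> nat" and R :: "('a::field_char_0 \<times> 'a) set"
  assumes e: "bij_betw e UNIV ({..<s} \<times> {..<s})" "\<And>i. fst (e i) + snd (e i) \<le> k"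
    and c: "c \<noteq> 0" "\<And>p. p \<in> R \<Longrightarrow> curve_value e c p = 0"
    and R: "finite R" "k \<le> M" "p \<in> R"
  shows "card (line_trace R p ` {q \<in> R. p \<noteq> q \<and> M < card (line_trace R p q)}) \<le> Suc k"
proof (rule ccontr)
  let ?L = "line_trace R p ` {q \<in> R. p \<noteq> q \<and> M < card (line_trace R p q)}"
  assume many: "\<not> card ?L \<le> Suc k"
  define f where "f = inv_into {q \<in> R. p \<noteq> q \<and> M < card (line_trace R p q)} (line_trace R p)"
  have f: "f t \<in> R \<and> p \<noteq> f t \<and> M < card (line_trace R p (f t)) \<and> line_trace R p (f t) = t" if "t \<in> ?L" for t
    using inv_into_into[OF that] f_inv_into_f[OF that] unfolding f_def by blast
  note f_in = f[THEN conjunct1] and f_ne = f[THEN conjunct2, THEN conjunct1]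
    and f_rich = f[THEN conjunct2, THEN conjunct2, THEN conjunct1]
  define V where "V = (\<lambda>t. f t - p) ` ?L"
  have "finite ?L" using R(1) by simp
  have inj: "inj_on (\<lambda>t. f t - p) ?L"
  proof (rule inj_onI)
    fix t t' assume t: "t \<in> ?L" "t' \<in> ?L" "f t - p = f t' - p"
    then have "f t = f t'" by simp
    then have "line_trace R p (f t) = line_trace R p (f t')" by (rule arg_cong)
    with f[OF t(1)] f[OF t(2)] show "t = t'" by argo
  qed
  have line: "curve_value e c (point_on p (f t - p) s) = 0" if t: "t \<in> ?L" for t s
  proof (rule curve_value_line_eq_0[OF e(2)])
    let ?T = "{s. point_on p (f t - p) s \<in> R}"
    have img: "line_trace R p (f t) = point_on p (f t - p) ` ?T"
      by (rule line_trace_eq_point_on[OF f_ne[OF t]])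
    have inj': "inj_on (point_on p (f t - p)) ?T"
      using f_ne[OF t] by (intro inj_on_subset[OF inj_point_on]) auto
    show "finite ?T"
      by (rule finite_imageD[OF _ inj'], rule finite_subset[OF _ R(1)]) auto
    show "k < card ?T"
      using f_rich[OF t] R(2) unfolding img card_image[OF inj'] by simp
    show "curve_value e c (point_on p (f t - p) s) = 0" if "s \<in> ?T" for s
      using c(2) that by simp
  qed
  have "curve_value e c z = 0" for z
  proof (rule curve_value_concurrent_lines[OF e(2)])
    show "finite V" using \<open>finite ?L\<close> by (simp add: V_def)
    show "Suc k < card V" using many by (simp add: V_def card_image[OF inj])
    show "fst d * snd d' \<noteq> fst d' * snd d" if d: "d \<in> V" "d' \<in> V" "d \<noteq> d'" for d d'
    proof
      assume eq: "fst d * snd d' = fst d' * snd d"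
      obtain t t' where t: "t \<in> ?L" "d = f t - p" "t' \<in> ?L" "d' = f t' - p"
        using d(1,2) unfolding V_def by blast
      have "aligned p (f t) (f t')"
        using eq t by (simp add: aligned_def)
      then have "line_trace R p (f t') = line_trace R p (f t)"
        using R(3) f_in[OF t(1)] f_in[OF t(3)] f_ne[OF t(1)] f_ne[OF t(3)]
        by (intro line_trace_cong) (auto simp: line_trace_def)
      with f[OF t(1)] f[OF t(3)] have "t = t'" by argo
      with t d(3) show False by blast
    qed
    show "curve_value e c (point_on p d t) = 0" if "d \<in> V" for d t
      using that line unfolding V_def by blast
  qed
  then have "c = 0" by (rule curve_value_all_zero[OF e(1)])
  with c(1) show False by simp
qed

lemma card_rich_pairs_on_curve:
  fixes e :: "'n::finite \<Rightarrow> nat \<times> nat" and R :: "('a::field_char_0 \<times> 'a) set"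
  assumes e: "bij_betw e UNIV ({..<s} \<times> {..<s})" "\<And>i. fst (e i) + snd (e i) \<le> k"
    and c: "c \<noteq> 0" "\<And>p. p \<in> R \<Longrightarrow> curve_value e c p = 0"
    and R: "finite R" "k \<le> M"
    and B: "\<And>t. t \<in> traces R \<Longrightarrow> card t \<le> B"
  shows "card (rich_pairs M R) \<le> card R * (Suc k * B)"
proof -
  have row: "card {q. (p, q) \<in> rich_pairs M R} \<le> Suc k * B" if "p \<in> R" for p
  proof -
    let ?L = "line_trace R p ` {q \<in> R. p \<noteq> q \<and> M < card (line_trace R p q)}"
    have fin: "finite ?L" using R(1) by simp
    have sub: "t \<subseteq> R" if "t \<in> ?L" for t using that unfolding line_trace_def by blast
    have "{q. (p, q) \<in> rich_pairs M R} \<subseteq> \<Union> ?L"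
    proof
      fix q assume "q \<in> {q. (p, q) \<in> rich_pairs M R}"
      then have q: "q \<in> R" "p \<noteq> q" "M < card (line_trace R p q)" by (auto simp: rich_pairs_def)
      then have "line_trace R p q \<in> ?L" by blast
      moreover have "q \<in> line_trace R p q" using q by (simp add: line_trace_def)
      ultimately show "q \<in> \<Union> ?L" by (rule UnionI)
    qed
    then have "card {q. (p, q) \<in> rich_pairs M R} \<le> card (\<Union> ?L)"
    proof (rule card_mono[rotated])
      have "\<Union> ?L \<subseteq> R" using sub by blast
      then show "finite (\<Union> ?L)" using R(1) by (rule finite_subset)
    qed
    also have "\<dots> \<le> (\<Sum>t\<in>?L. card t)"
      by (rule card_Union_le_sum_card)
    also have "\<dots> \<le> (\<Sum>t\<in>?L. B)"
    proof (rule sum_mono)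
      fix t assume "t \<in> ?L"
      then have "t \<in> traces R" using \<open>p \<in> R\<close> line_trace_in_traces by blast
      then show "card t \<le> B" by (rule B)
    qed
    also have "\<dots> = card ?L * B" by simp
    also have "\<dots> \<le> Suc k * B"
      by (intro mult_right_mono card_rich_lines_through_point[OF e c R that]) auto
    finally show ?thesis .
  qed
  have Sig: "rich_pairs M R = Sigma R (\<lambda>p. {q. (p, q) \<in> rich_pairs M R})"
    by (auto simp: rich_pairs_def)
  have "{q. (p, q) \<in> rich_pairs M R} \<subseteq> R" for p by (auto simp: rich_pairs_def)
  then have "\<forall>p\<in>R. finite {q. (p, q) \<in> rich_pairs M R}" using R(1) finite_subset by blast
  from Sig have "card (rich_pairs M R) = card (Sigma R (\<lambda>p. {q. (p, q) \<in> rich_pairs M R}))"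
    by (rule arg_cong)
  also have "\<dots> = (\<Sum>p\<in>R. card {q. (p, q) \<in> rich_pairs M R})"
    by (rule card_SigmaI) fact+
  also have "\<dots> \<le> (\<Sum>p\<in>R. Suc k * B)" by (intro sum_mono row)
  finally show ?thesis by simp
qed

section \<open>The dichotomy over the complex numbers\<close>

lemma line_trace_mono: "R \<subseteq> P \<Longrightarrow> line_trace R p q \<subseteq> line_trace P p q"
  by (auto simp: line_trace_def)

text \<open>At most half of all pairs are rich and, as \<open>4 \<le> card Q\<close>, at most a
  quarter are diagonal. At least a quarter is poor and is counted by
  \<open>card_poor_pairs_le\<close>; the other factor 4 comes from
  \<open>card P \<le> 2 * card Q\<close>.\<close>

lemma many_traces:
  assumes P: "finite P" "Q \<subseteq> P" "card P \<le> 2 * card Q" "4 \<le> card Q"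
    and rich: "2 * card (rich_pairs M Q) \<le> (card Q)\<^sup>2"
  shows "(card P)\<^sup>2 \<le> 16 * M\<^sup>2 * card (traces P)"
proof -
  have fin: "finite Q" using P finite_subset by blast
  have "card (rich_pairs M Q) + card (poor_pairs M Q) + card Q = (card Q)\<^sup>2"
    by (rule card_rich_plus_poor[OF fin])
  moreover have "4 * card Q \<le> (card Q)\<^sup>2"
    using P(4) by (simp add: power2_eq_square)
  ultimately have "(card Q)\<^sup>2 \<le> 4 * card (poor_pairs M Q)" using rich by linarith
  also have "\<dots> \<le> 4 * (M\<^sup>2 * card (traces P))"
    by (intro mult_left_mono card_poor_pairs_le P) auto
  finally have "4 * (card Q)\<^sup>2 \<le> 16 * M\<^sup>2 * card (traces P)" by linarith
  moreover have "(card P)\<^sup>2 \<le> (2 * card Q)\<^sup>2" using P(3) by (intro power_mono) auto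
  then have "(card P)\<^sup>2 \<le> 4 * (card Q)\<^sup>2" by (simp add: power_mult_distrib)
  ultimately show ?thesis by linarith
qed

text \<open>The dichotomy for \<open>c = 1 / 10^7\<close> with denominators cleared. The constant
  dominates \<open>16 * 508^2 = 4129024\<close>, the factor reached in
  \<open>beck_complex\<close>.\<close>

definition beck_property :: "('a::field \<times> 'a) set \<Rightarrow> bool" where
  "beck_property P \<longleftrightarrow> (\<exists>t\<in>traces P. card P \<le> 10 ^ 7 * card t) \<or> (card P)\<^sup>2 \<le> 10 ^ 7 * card (traces P)"

lemma beck_complex:
  fixes P :: "(complex \<times> complex) set"
  assumes P: "finite P" "card P \<noteq> 1"
  shows "beck_property P"
proof (rule ccontr)
  assume "\<not> beck_property P"
  then have small: "\<And>t. t \<in> traces P \<Longrightarrow> 10 ^ 7 * card t < card P"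
    and few: "10 ^ 7 * card (traces P) < (card P)\<^sup>2"
    by (auto simp: beck_property_def not_le)
  have "card P \<noteq> 0"
  proof
    assume "card P = 0"
    with few show False by (simp only:) simp
  qed
  with P(2) have "card P \<ge> 2" by linarith
  then obtain p q where pq: "p \<in> P" "q \<in> P" "p \<noteq> q"
    by (metis card_2_iff' ex_card subset_iff)
  have "card {p, q} \<le> card (line_trace P p q)"
    using P(1) pq by (intro card_mono) (auto simp: line_trace_def)
  \<comment> \<open>A trace has at least two points, so failure of the first alternative makes
    \<open>P\<close> large; this supplies \<open>4 \<le> card Q\<close> for
    \<open>many_traces\<close>.\<close>
  then have large: "2 * 10 ^ 7 < card P"
    using small[OF line_trace_in_traces[OF pq]] pq(3) by simp
  txt \<open>The \<open>64\<^sup>2\<close> monomials of bidegree less than 64 restrict to polynomials of degree at most 126 on each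
    line. Both 64 and the richness threshold \<open>508 = 4 * 127\<close> are chosen so that \<open>2 * 16 * 127 \<le> 64\<^sup>2\<close>: by
    \<open>card_rich_pairs_balanced\<close>, at most half of the pairs of a balanced set are rich.\<close>
  have "card (UNIV :: 4096 set) = card ({..<64::nat} \<times> {..<64::nat})"
    by (simp add: card_cartesian_product)
  then obtain e :: "4096 \<Rightarrow> nat \<times> nat" where e: "bij_betw e UNIV ({..<64} \<times> {..<64})"
    using finite_same_card_bij[of "UNIV :: 4096 set" "{..<64::nat} \<times> {..<64::nat}"] by auto
  have deg: "fst (e i) + snd (e i) \<le> 126" for i
  proof -
    have "e i \<in> {..<64} \<times> {..<64}" using bij_betw_apply[OF e, of i] by simp
    then show ?thesis by (auto simp: mem_Times_iff)
  qed
  obtain Q m c where Q: "Q \<subseteq> P" "balanced (veronese e) Q m" "c \<noteq> 0"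
    "\<And>p. p \<in> P - Q \<Longrightarrow> (\<Sum>i\<in>UNIV. veronese e p $ i * c $ i) = 0"
    using exists_balanced_subset[OF P(1), of "veronese e"] by blast
  have fin: "finite Q" "finite (P - Q)" using Q(1) P(1) finite_subset by auto
  have "card P = card Q + card (P - Q)"
    using P(1) Q(1) by (metis card_Diff_subset card_mono fin(1) le_add_diff_inverse)
  then consider "card P \<le> 2 * card Q" | "card P \<le> 2 * card (P - Q)" by linarith
  then have "(card P)\<^sup>2 \<le> 16 * 508\<^sup>2 * card (traces P)"
  proof cases
    case 1
    have "card (rich_pairs 508 Q) * 4096 \<le> 2032 * (card Q)\<^sup>2"
      using card_rich_pairs_balanced[OF Q(2) fin(1) deg] by simp
    then show ?thesis
      using 1 large Q(1) P(1) by (intro many_traces) auto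
  next
    case 2
    let ?R = "P - Q"
    have "card t \<le> card P div 10 ^ 7" if t: "t \<in> traces ?R" for t
    proof -
      obtain p q where pq: "p \<in> ?R" "q \<in> ?R" "p \<noteq> q" "t = line_trace ?R p q"
        using t by (auto simp: traces_def)
      have "card t \<le> card (line_trace P p q)"
        unfolding pq(4) using P(1) by (intro card_mono line_trace_mono) (auto simp: line_trace_def)
      moreover have "10 ^ 7 * card (line_trace P p q) < card P"
        using pq by (intro small line_trace_in_traces) auto
      ultimately show ?thesis by (simp add: less_eq_div_iff_mult_less_eq)
    qed
    then have "card (rich_pairs 508 ?R) \<le> card ?R * (Suc 126 * (card P div 10 ^ 7))"
      using Q(3,4) fin(2) by (intro card_rich_pairs_on_curve[OF e deg]) (auto simp: curve_value_def)
    \<comment> \<open>This rests on \<open>4 * 127 \<le> 10^7\<close>: lines carry so few points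
      that the at most 127 rich lines through a point of \<open>?R\<close> cover at most half of
      \<open>?R\<close>.\<close>
    moreover have "4 * (Suc 126 * (card P div 10 ^ 7)) \<le> card P"
      using div_times_less_eq_dividend[of "card P" "10 ^ 7"] by simp
    then have "2 * (Suc 126 * (card P div 10 ^ 7)) \<le> card ?R"
      using 2 by linarith
    then have "card ?R * (2 * (Suc 126 * (card P div 10 ^ 7))) \<le> card ?R * card ?R"
      by (rule mult_left_mono) simp
    ultimately have "2 * card (rich_pairs 508 ?R) \<le> (card ?R)\<^sup>2"
      unfolding power2_eq_square by linarith
    then show ?thesis
      using 2 large P(1) by (intro many_traces) auto
  qed
  with few show False by simp
qed

section \<open>Embedding finitely generated domains into the complex numbers\<close>

text \<open>An isomorphism between subrings of two integral domains, represented by its graph. Working with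
  subrings instead of subfields avoids quotients; pseudo-division replaces division with remainder.\<close>

locale ring_graph =
  fixes G :: "('a::idom \<times> 'b::idom) set"
  assumes one_mem: "(1, 1) \<in> G"
    and add_mem: "(a, b) \<in> G \<Longrightarrow> (c, d) \<in> G \<Longrightarrow> (a + c, b + d) \<in> G"
    and mult_mem: "(a, b) \<in> G \<Longrightarrow> (c, d) \<in> G \<Longrightarrow> (a * c, b * d) \<in> G"
    and uminus_mem: "(a, b) \<in> G \<Longrightarrow> (- a, - b) \<in> G"
    and zero_iff: "(a, b) \<in> G \<Longrightarrow> a = 0 \<longleftrightarrow> b = 0"
begin

lemma zero_mem: "(0, 0) \<in> G"
  using add_mem[OF one_mem uminus_mem[OF one_mem]] by simp

lemma diff_mem: "(a, b) \<in> G \<Longrightarrow> (c, d) \<in> G \<Longrightarrow> (a - c, b - d) \<in> G"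
  using add_mem[of a b "- c" "- d"] uminus_mem[of c d] by simp

lemma eq_iff: "(a, b) \<in> G \<Longrightarrow> (c, d) \<in> G \<Longrightarrow> a = c \<longleftrightarrow> b = d"
  using zero_iff[OF diff_mem, of a b c d] by simp

lemma sum_mem: "(\<And>i. i \<in> I \<Longrightarrow> (f i, g i) \<in> G) \<Longrightarrow> (sum f I, sum g I) \<in> G"
  by (induction I rule: infinite_finite_induct) (auto intro: zero_mem add_mem)

text \<open>The graph of the induced isomorphism between the polynomial rings over the two
  subrings.\<close>

definition poly_graph :: "('a poly \<times> 'b poly) set" where
  "poly_graph = {(p, q). \<forall>i. (coeff p i, coeff q i) \<in> G}"

lemma poly_graphD: "(p, q) \<in> poly_graph \<Longrightarrow> (coeff p i, coeff q i) \<in> G"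
  by (simp add: poly_graph_def)

lemma poly_graph_add: "(p, q) \<in> poly_graph \<Longrightarrow> (r, s) \<in> poly_graph \<Longrightarrow> (p + r, q + s) \<in> poly_graph"
  by (simp add: poly_graph_def add_mem)

lemma poly_graph_diff: "(p, q) \<in> poly_graph \<Longrightarrow> (r, s) \<in> poly_graph \<Longrightarrow> (p - r, q - s) \<in> poly_graph"
  by (simp add: poly_graph_def diff_mem)

lemma poly_graph_uminus: "(p, q) \<in> poly_graph \<Longrightarrow> (- p, - q) \<in> poly_graph"
  by (simp add: poly_graph_def uminus_mem)

lemma poly_graph_mult: "(p, q) \<in> poly_graph \<Longrightarrow> (r, s) \<in> poly_graph \<Longrightarrow> (p * r, q * s) \<in> poly_graph"
  by (simp add: poly_graph_def coeff_mult sum_mem mult_mem)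

lemma poly_graph_monom: "(a, b) \<in> G \<Longrightarrow> (monom a n, monom b n) \<in> poly_graph"
  by (simp add: poly_graph_def zero_mem)

lemma poly_graph_0: "(0, 0) \<in> poly_graph"
  by (simp add: poly_graph_def zero_mem)

lemma poly_graph_smult: "(a, b) \<in> G \<Longrightarrow> (p, q) \<in> poly_graph \<Longrightarrow> (smult a p, smult b q) \<in> poly_graph"
  by (simp add: poly_graph_def mult_mem)

lemma poly_graph_degree: "(p, q) \<in> poly_graph \<Longrightarrow> degree p = degree q"
  unfolding degree_def using zero_iff[OF poly_graphD] by (intro arg_cong[where f=Least] ext) metis

lemma poly_graph_zero_iff: "(p, q) \<in> poly_graph \<Longrightarrow> p = 0 \<longleftrightarrow> q = 0"
  using zero_iff[OF poly_graphD] by (simp add: poly_eq_iff)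

text \<open>The dividend is multiplied by the leading coefficient of \<open>m\<close>, on both sides
  of the graph at once, so that multipliers, quotients and remainders correspond.\<close>

lemma poly_graph_pseudo_division:
  assumes m: "(m, m') \<in> poly_graph" "m \<noteq> 0" and p: "(p, p') \<in> poly_graph"
  shows "\<exists>c c' q q' r r'. (c, c') \<in> G \<and> c \<noteq> 0 \<and> (q, q') \<in> poly_graph \<and> (r, r') \<in> poly_graph \<and>
    smult c p = q * m + r \<and> smult c' p' = q' * m' + r' \<and> (r = 0 \<or> degree r < degree m)"
  using p
proof (induction "degree p" arbitrary: p p' rule: less_induct)
  case less
  show ?case
  proof (cases "p = 0 \<or> degree p < degree m")
    case True
    with less.prems show ?thesis
      by (intro exI[of _ 1] exI[of _ 0] exI[of _ p] exI[of _ p']) (auto simp: one_mem poly_graph_0)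
  next
    case False
    define a a' b b' k where ab: "a = lead_coeff p" "a' = lead_coeff p'" "b = lead_coeff m" "b' = lead_coeff m'"
      "k = degree p - degree m"
    have deg: "degree p' = degree p" "degree m' = degree m"
      using poly_graph_degree less.prems m by auto
    have abG: "(a, a') \<in> G" "(b, b') \<in> G"
      using poly_graphD[OF less.prems, of "degree p"] poly_graphD[OF m(1), of "degree m"] deg by (auto simp: ab)
    define s s' where s: "s = smult b p - monom a k * m" "s' = smult b' p' - monom a' k * m'"
    have sG: "(s, s') \<in> poly_graph"
      unfolding s using abG m(1) less.prems
      by (intro poly_graph_diff poly_graph_smult poly_graph_mult poly_graph_monom)
    have "degree (monom a k * m) \<le> degree p"
      using degree_mult_le[of "monom a k" m] degree_monom_le[of a k] False ab(5) by linarith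
    then have "degree s \<le> degree p"
      unfolding s by (intro degree_diff_le) (auto intro: order.trans[OF degree_smult_le])
    moreover have "coeff s (degree p) = 0"
    proof -
      have "coeff (monom a k * m) (degree p) = a * b"
        using False coeff_monom_mult[of a k m "degree p"] by (simp add: ab)
      then show ?thesis by (simp add: s ab mult.commute)
    qed
    \<comment> \<open>The zero polynomial is split off because its degree 0 need not be smaller than
      that of \<open>p\<close>.\<close>
    ultimately consider "s = 0" | "degree s < degree p"
      using eq_zero_or_degree_less by blast
    then show ?thesis
    proof cases
      case 1
      then have "s' = 0" using poly_graph_zero_iff[OF sG] by simp
      with 1 have "smult b p = monom a k * m + 0" "smult b' p' = monom a' k * m' + 0"
        by (simp_all add: s)
      then show ?thesis
        using abG m(2) poly_graph_monom[OF abG(1), of k] poly_graph_0 unfolding ab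
        by (metis leading_coeff_0_iff)
    next
      case 2
      obtain c c' q q' r r' where IH: "(c, c') \<in> G" "c \<noteq> 0" "(q, q') \<in> poly_graph" "(r, r') \<in> poly_graph"
        "smult c s = q * m + r" "smult c' s' = q' * m' + r'" "r = 0 \<or> degree r < degree m"
        using less.hyps[OF 2 sG] by blast
      have "smult (c * b) p = (q + smult c (monom a k)) * m + r"
        "smult (c' * b') p' = (q' + smult c' (monom a' k)) * m' + r'"
        using IH(5,6) by (simp_all add: s smult_diff_right algebra_simps)
      moreover have "(q + smult c (monom a k), q' + smult c' (monom a' k)) \<in> poly_graph"
        using IH abG by (intro poly_graph_add poly_graph_smult poly_graph_monom)
      moreover have "(c * b, c' * b') \<in> G" "c * b \<noteq> 0"
        using IH abG m(2) by (auto intro: mult_mem simp: ab)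
      ultimately show ?thesis using IH(4,7) by blast
    qed
  qed
qed

definition adjoin :: "'a \<Rightarrow> 'b \<Rightarrow> ('a \<times> 'b) set" where
  "adjoin x y = {(poly p x, poly q y) | p q. (p, q) \<in> poly_graph}"

lemma adjoin_superset: "G \<subseteq> adjoin x y"
proof (rule subrelI)
  fix a b assume "(a, b) \<in> G"
  from poly_graph_monom[OF this, of 0] show "(a, b) \<in> adjoin x y"
    unfolding adjoin_def by (force simp: poly_monom)
qed

lemma adjoin_mem: "(x, y) \<in> adjoin x y"
  using poly_graph_monom[OF one_mem, of 1] unfolding adjoin_def by (force simp: poly_monom)

text \<open>Closure under the ring operations is automatic; the assumption is exactly what makes the
  extended relation single-valued in both directions.\<close>

lemma ring_graph_adjoin:
  assumes "\<And>p q. (p, q) \<in> poly_graph \<Longrightarrow> poly p x = 0 \<longleftrightarrow> poly q y = 0"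
  shows "ring_graph (adjoin x y)"
proof
  show "(1, 1) \<in> adjoin x y" using adjoin_superset one_mem by blast
  fix a b assume "(a, b) \<in> adjoin x y"
  then obtain p q where pq: "(p, q) \<in> poly_graph" "a = poly p x" "b = poly q y"
    by (auto simp: adjoin_def)
  show "a = 0 \<longleftrightarrow> b = 0" using assms pq by simp
  have "(- a, - b) = (poly (- p) x, poly (- q) y)" using pq by simp
  with poly_graph_uminus[OF pq(1)] show "(- a, - b) \<in> adjoin x y"
    unfolding adjoin_def by blast
  fix c d assume "(c, d) \<in> adjoin x y"
  then obtain r s where rs: "(r, s) \<in> poly_graph" "c = poly r x" "d = poly s y"
    by (auto simp: adjoin_def)
  have "(a + c, b + d) = (poly (p + r) x, poly (q + s) y)" using pq rs by simp
  with poly_graph_add[OF pq(1) rs(1)] show "(a + c, b + d) \<in> adjoin x y"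
    unfolding adjoin_def by blast
  have "(a * c, b * d) = (poly (p * r) x, poly (q * s) y)" using pq rs by simp
  with poly_graph_mult[OF pq(1) rs(1)] show "(a * c, b * d) \<in> adjoin x y"
    unfolding adjoin_def by blast
qed

text \<open>Here \<open>m\<close> acts as a minimal polynomial of \<open>x\<close>, and one
  direction is pseudo-division by \<open>m\<close>. For the other, take \<open>n'\<close> of least
  degree vanishing at \<open>y\<close>: its counterpart \<open>n\<close> divides \<open>m\<close>
  and \<open>p\<close> up to constants, and minimality of \<open>m\<close> forces \<open>n\<close>
  to vanish at \<open>x\<close>.\<close>

lemma common_root_transfer:
  assumes m: "(m, m') \<in> poly_graph" "m \<noteq> 0" "poly m x = 0" "poly m' y = 0"
    and least: "\<And>p q. (p, q) \<in> poly_graph \<Longrightarrow> p \<noteq> 0 \<Longrightarrow> poly p x = 0 \<Longrightarrow> degree m \<le> degree p"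
    and p: "(p, q) \<in> poly_graph"
  shows "poly p x = 0 \<longleftrightarrow> poly q y = 0"
proof
  assume root: "poly p x = 0"
  obtain c c' d d' r r' where div: "(c, c') \<in> G" "c \<noteq> 0" "(r, r') \<in> poly_graph"
    "smult c p = d * m + r" "smult c' q = d' * m' + r'" "r = 0 \<or> degree r < degree m"
    using poly_graph_pseudo_division[OF m(1,2) p] by blast
  have "poly r x = 0"
    using arg_cong[OF div(4), of "\<lambda>p. poly p x"] root m(3) by simp
  then have "r = 0" using least[OF div(3)] div(6) by force
  then have "r' = 0" using poly_graph_zero_iff[OF div(3)] by simp
  then have "c' * poly q y = 0"
    using arg_cong[OF div(5), of "\<lambda>p. poly p y"] m(4) by simp
  then show "poly q y = 0" using zero_iff[OF div(1)] div(2) by simp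
next
  assume root: "poly q y = 0"
  define S where "S = (\<lambda>(n, n'). (n, n') \<in> poly_graph \<and> n' \<noteq> 0 \<and> poly n' y = 0)"
  have "S (m, m')" using m poly_graph_zero_iff[OF m(1)] by (simp add: S_def)
  then obtain nn where "S nn" "\<And>k. S k \<Longrightarrow> degree (snd nn) \<le> degree (snd k)"
    using ex_has_least_nat[of S "(m, m')" "\<lambda>k. degree (snd k)"] by blast
  then obtain n n' where n: "(n, n') \<in> poly_graph" "n' \<noteq> 0" "poly n' y = 0"
    and min: "\<And>k k'. (k, k') \<in> poly_graph \<Longrightarrow> k' \<noteq> 0 \<Longrightarrow> poly k' y = 0 \<Longrightarrow> degree n' \<le> degree k'"
    by (cases nn) (force simp: S_def)
  have "n \<noteq> 0" using n poly_graph_zero_iff[OF n(1)] by simp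
  have multiple: "\<exists>c d d'. c \<noteq> 0 \<and> (d, d') \<in> poly_graph \<and> smult c f = d * n"
    if f: "(f, f') \<in> poly_graph" "poly f' y = 0" for f f'
  proof -
    obtain c c' d d' r r' where div: "(c, c') \<in> G" "c \<noteq> 0" "(d, d') \<in> poly_graph" "(r, r') \<in> poly_graph"
      "smult c f = d * n + r" "smult c' f' = d' * n' + r'" "r = 0 \<or> degree r < degree n"
      using poly_graph_pseudo_division[OF n(1) \<open>n \<noteq> 0\<close> f(1)] by blast
    have "poly r' y = 0"
      using arg_cong[OF div(6), of "\<lambda>p. poly p y"] f(2) n(3) by simp
    then have "r' = 0"
      using min[OF div(4)] div(7) poly_graph_degree[OF div(4)] poly_graph_degree[OF n(1)]
        poly_graph_zero_iff[OF div(4)] by force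
    then have "r = 0" using poly_graph_zero_iff[OF div(4)] by simp
    with div show ?thesis by auto
  qed
  \<comment> \<open>Otherwise the cofactor \<open>d\<close> of \<open>n\<close> in a multiple of
    \<open>m\<close> vanishes at \<open>x\<close>, so \<open>degree d \<ge> degree m\<close>, and
    \<open>n'\<close> is a nonzero constant with a root.\<close>
  have "poly n x = 0"
  proof (rule ccontr)
    assume nx: "poly n x \<noteq> 0"
    obtain c d d' where div: "c \<noteq> 0" "(d, d') \<in> poly_graph" and eq: "smult c m = d * n"
      using multiple[OF m(1,4)] by blast
    from eq have "poly (smult c m) x = poly (d * n) x" by (rule arg_cong)
    then have "poly d x = 0" using m(3) nx by simp
    moreover have "d \<noteq> 0" using eq div(1) m(2) by auto
    ultimately have "degree m \<le> degree d" using least[OF div(2)] by simp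
    moreover have "degree (smult c m) = degree (d * n)" using eq by (rule arg_cong)
    then have "degree m = degree d + degree n"
      using div(1) \<open>d \<noteq> 0\<close> \<open>n \<noteq> 0\<close> by (simp add: degree_mult_eq)
    ultimately have "degree n' = 0" using poly_graph_degree[OF n(1)] by simp
    then obtain z where "n' = [:z:]" by (rule degree_eq_zeroE)
    with n(2,3) show False by simp
  qed
  obtain c d where "c \<noteq> 0" and eq: "smult c p = d * n" using multiple[OF p root] by blast
  from eq have "poly (smult c p) x = poly (d * n) x" by (rule arg_cong)
  then have "c * poly p x = 0" using \<open>poly n x = 0\<close> by simp
  with \<open>c \<noteq> 0\<close> show "poly p x = 0" by simp
qed

end

lemma countable_coeffs_subset:
  assumes "countable S"
  shows "countable {q :: 'a::zero poly. set (coeffs q) \<subseteq> S}"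
proof (rule countable_image_inj_on)
  show "countable (coeffs ` {q. set (coeffs q) \<subseteq> S})"
    by (rule countable_subset[OF _ countable_lists[OF assms]]) auto
  show "inj_on coeffs {q. set (coeffs q) \<subseteq> S}" by (simp add: inj_on_def coeffs_eq_iff)
qed

text \<open>If \<open>x\<close> is algebraic over the first subring, \<open>y\<close> is a root of
  the counterpart of a minimal polynomial; otherwise \<open>y\<close> avoids the countably many
  roots of nonzero polynomials over the second. Countability is passed on so that the step can be
  repeated.\<close>

lemma ring_graph_extend:
  fixes G :: "('a::idom \<times> complex) set" and x :: 'a
  assumes "ring_graph G" "countable G"
  shows "\<exists>G' y. ring_graph G' \<and> countable G' \<and> G \<subseteq> G' \<and> (x, y) \<in> G'"
proof -
  interpret ring_graph G by fact
  have "poly_graph \<subseteq> {p. set (coeffs p) \<subseteq> fst ` G} \<times> {q. set (coeffs q) \<subseteq> snd ` G}"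
  proof (rule subrelI)
    fix p q assume pq: "(p, q) \<in> poly_graph"
    have "range (coeff p) \<subseteq> fst ` G" "range (coeff q) \<subseteq> snd ` G"
      using poly_graphD[OF pq] by force+
    then show "(p, q) \<in> {p. set (coeffs p) \<subseteq> fst ` G} \<times> {q. set (coeffs q) \<subseteq> snd ` G}"
      by (auto simp: range_coeff)
  qed
  then have countable: "countable poly_graph"
    by (rule countable_subset) (intro countable_SIGMA countable_coeffs_subset countable_image assms(2))
  have "\<exists>y. \<forall>(p, q) \<in> poly_graph. poly p x = 0 \<longleftrightarrow> poly q y = 0"
  proof (cases "\<exists>(m, m') \<in> poly_graph. m \<noteq> 0 \<and> poly m x = 0")
    case True
    define S where "S = (\<lambda>(m, m'). (m, m') \<in> poly_graph \<and> m \<noteq> 0 \<and> poly m x = 0)"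
    from True obtain mm where "S mm" by (auto simp: S_def)
    then obtain mm where "S mm" "\<And>k. S k \<Longrightarrow> degree (fst mm) \<le> degree (fst k)"
      using ex_has_least_nat[of S mm "\<lambda>k. degree (fst k)"] by blast
    then obtain m m' where m: "(m, m') \<in> poly_graph" "m \<noteq> 0" "poly m x = 0"
      and least: "\<And>k k'. (k, k') \<in> poly_graph \<Longrightarrow> k \<noteq> 0 \<Longrightarrow> poly k x = 0 \<Longrightarrow> degree m \<le> degree k"
      by (cases mm) (force simp: S_def)
    have "degree m \<noteq> 0"
    proof
      assume "degree m = 0"
      then obtain z where "m = [:z:]" by (rule degree_eq_zeroE)
      with m(2,3) show False by simp
    qed
    then have "\<not> constant (poly m')"
      using poly_graph_degree[OF m(1)] by (simp add: constant_degree)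
    then obtain y where y: "poly m' y = 0" using fundamental_theorem_of_algebra by blast
    have "poly p x = 0 \<longleftrightarrow> poly q y = 0" if "(p, q) \<in> poly_graph" for p q
      by (rule common_root_transfer[OF m y _ that]) (rule least)
    then show ?thesis by blast
  next
    case False
    have "countable (\<Union>q\<in>snd ` poly_graph - {0}. {y. poly q y = 0})"
    proof (rule countable_UN)
      show "countable (snd ` poly_graph - {0})" using countable by blast
      show "countable {y. poly q y = 0}" if "q \<in> snd ` poly_graph - {0}" for q
        using that by (intro countable_finite poly_roots_finite) auto
    qed
    then obtain y where y: "y \<notin> (\<Union>q\<in>snd ` poly_graph - {0}. {y. poly q y = 0})"
      using uncountable_UNIV_complex by (metis UNIV_eq_I)
    have "poly p x = 0 \<longleftrightarrow> poly q y = 0" if pq: "(p, q) \<in> poly_graph" for p q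
    proof (cases "p = 0")
      case True
      then show ?thesis using poly_graph_zero_iff[OF pq] by simp
    next
      case nz: False
      then have "q \<noteq> 0" using poly_graph_zero_iff[OF pq] by simp
      have "poly p x \<noteq> 0" using False pq nz by blast
      moreover have "poly q y \<noteq> 0" using y pq \<open>q \<noteq> 0\<close> by force
      ultimately show ?thesis by simp
    qed
    then show ?thesis by blast
  qed
  then obtain y where y: "\<And>p q. (p, q) \<in> poly_graph \<Longrightarrow> poly p x = 0 \<longleftrightarrow> poly q y = 0" by blast
  have "adjoin x y = (\<lambda>(p, q). (poly p x, poly q y)) ` poly_graph"
    by (auto simp: adjoin_def)
  then have "countable (adjoin x y)" using countable by simp
  then show ?thesis
    using ring_graph_adjoin[OF y] adjoin_superset adjoin_mem by blast
qed

text \<open>The start of the construction. Characteristic 0 enters here: an integer vanishes on one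
  side iff it vanishes on the other.\<close>

lemma ring_graph_of_int: "ring_graph (range (\<lambda>n. (of_int n :: 'a::{idom,ring_char_0}, of_int n :: complex)))"
proof
  show "(1, 1) \<in> range (\<lambda>n. (of_int n :: 'a, of_int n :: complex))"
    by (rule range_eqI[of _ _ 1]) simp
qed (auto simp flip: of_int_add of_int_mult of_int_minus)

lemma finite_embedding:
  fixes S :: "'a::{idom,ring_char_0} set"
  assumes "finite S"
  shows "\<exists>G :: ('a \<times> complex) set. ring_graph G \<and> countable G \<and> (\<forall>x\<in>S. \<exists>y. (x, y) \<in> G)"
  using assms
proof (induction S)
  case empty
  show ?case using ring_graph_of_int by (intro exI[of _ "range (\<lambda>n. (of_int n, of_int n))"]) auto
next
  case (insert x S)
  then obtain G :: "('a \<times> complex) set" where G: "ring_graph G" "countable G" "\<forall>x\<in>S. \<exists>y. (x, y) \<in> G"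
    by blast
  obtain G' y where "ring_graph G'" "countable G'" "G \<subseteq> G'" "(x, y) \<in> G'"
    using ring_graph_extend[OF G(1,2)] by blast
  with G(3) show ?case by blast
qed

section \<open>Lines over arbitrary fields\<close>

lemma beck_property_transfer:
  assumes inj: "inj_on h P"
    and aligned: "\<And>p q r. p \<in> P \<Longrightarrow> q \<in> P \<Longrightarrow> r \<in> P \<Longrightarrow> aligned (h p) (h q) (h r) \<longleftrightarrow> aligned p q r"
    and beck: "beck_property (h ` P)"
  shows "beck_property P"
proof -
  have trace: "line_trace (h ` P) (h p) (h q) = h ` line_trace P p q" if "p \<in> P" "q \<in> P" for p q
    unfolding line_trace_def using aligned[OF that] by blast
  have card_t: "card (h ` t) = card t" if "t \<in> traces P" for t
    using that by (intro card_image inj_on_subset[OF inj]) (auto simp: traces_def line_trace_def)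
  have image: "traces (h ` P) \<subseteq> (`) h ` traces P"
  proof
    fix t assume "t \<in> traces (h ` P)"
    then obtain p q where pq: "p \<in> P" "q \<in> P" "h p \<noteq> h q" "t = line_trace (h ` P) (h p) (h q)"
      unfolding traces_def by blast
    then have "t = h ` line_trace P p q" "p \<noteq> q" using trace by auto
    then show "t \<in> (`) h ` traces P" using line_trace_in_traces[OF pq(1,2)] by blast
  qed
  from beck show ?thesis
    unfolding beck_property_def
  proof
    assume "\<exists>t\<in>traces (h ` P). card (h ` P) \<le> 10 ^ 7 * card t"
    then obtain t where "t \<in> traces P" "card (h ` P) \<le> 10 ^ 7 * card (h ` t)" using image by blast
    then show "(\<exists>t\<in>traces P. card P \<le> 10 ^ 7 * card t) \<or> (card P)\<^sup>2 \<le> 10 ^ 7 * card (traces P)"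
      using card_t card_image[OF inj] by auto
  next
    assume many: "(card (h ` P))\<^sup>2 \<le> 10 ^ 7 * card (traces (h ` P))"
    show "(\<exists>t\<in>traces P. card P \<le> 10 ^ 7 * card t) \<or> (card P)\<^sup>2 \<le> 10 ^ 7 * card (traces P)"
    \<comment> \<open>For infinite \<open>P\<close> the value of \<open>card P\<close> is 0 and the
      second alternative is trivial.\<close>
    proof (cases "finite P")
      case True
      have "card (traces (h ` P)) \<le> card (traces P)"
        using image finite_traces[OF True] by (rule surj_card_le[rotated])
      with many card_image[OF inj] show ?thesis by simp
    qed simp
  qed
qed

text \<open>It suffices to embed the ring generated by the finitely many coordinates; collinearity
  is an equation between products of differences, so it is preserved and reflected.\<close>

theorem beck_char_0:
  fixes P :: "('a::field_char_0 \<times> 'a) set"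
  assumes "finite P" "card P \<noteq> 1"
  shows "beck_property P"
proof -
  obtain G :: "('a \<times> complex) set" where G: "ring_graph G" "\<forall>x\<in>fst ` P \<union> snd ` P. \<exists>y. (x, y) \<in> G"
    using finite_embedding[of "fst ` P \<union> snd ` P"] assms(1) by auto
  interpret ring_graph G by (rule G(1))
  obtain f where f: "\<forall>x\<in>fst ` P \<union> snd ` P. (x, f x) \<in> G" using bchoice[OF G(2)] by blast
  define h where "h p = (f (fst p), f (snd p))" for p
  have mem: "(fst p, fst (h p)) \<in> G" "(snd p, snd (h p)) \<in> G" if "p \<in> P" for p
    using f that by (auto simp: h_def)
  have inj: "inj_on h P"
    using eq_iff[OF mem(1) mem(1)] eq_iff[OF mem(2) mem(2)] by (intro inj_onI prod_eqI) metis+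
  have "aligned (h p) (h q) (h r) \<longleftrightarrow> aligned p q r" if "p \<in> P" "q \<in> P" "r \<in> P" for p q r
    unfolding aligned_def
    by (rule eq_iff[symmetric]; intro mult_mem diff_mem mem that)
  moreover have "beck_property (h ` P)"
    using assms card_image[OF inj] by (intro beck_complex) auto
  ultimately show ?thesis by (rule beck_property_transfer[OF inj])
qed

section \<open>Lines over a field given as a record\<close>

lemma (in field) line_through_two_points:
  assumes coeffs: "a \<in> carrier R" "b \<in> carrier R" "c \<in> carrier R" "(a, b) \<noteq> (\<zero>, \<zero>)"
      "a' \<in> carrier R" "b' \<in> carrier R" "c' \<in> carrier R"
    and points: "x1 \<in> carrier R" "y1 \<in> carrier R" "x2 \<in> carrier R" "y2 \<in> carrier R" "(x1, y1) \<noteq> (x2, y2)"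
      "x \<in> carrier R" "y \<in> carrier R"
    and on: "a \<otimes> x1 \<oplus> b \<otimes> y1 \<oplus> c = \<zero>" "a \<otimes> x2 \<oplus> b \<otimes> y2 \<oplus> c = \<zero>" "a \<otimes> x \<oplus> b \<otimes> y \<oplus> c = \<zero>"
      "a' \<otimes> x1 \<oplus> b' \<otimes> y1 \<oplus> c' = \<zero>" "a' \<otimes> x2 \<oplus> b' \<otimes> y2 \<oplus> c' = \<zero>"
  shows "a' \<otimes> x \<oplus> b' \<otimes> y \<oplus> c' = \<zero>"
proof -
  define u v w z where uv: "u = x2 \<ominus> x1" "v = y2 \<ominus> y1" "w = x \<ominus> x1" "z = y \<ominus> y1"
  note closed [simp] = coeffs(1-3,5-7) points(1-4,6,7)
  have [simp]: "u \<in> carrier R" "v \<in> carrier R" "w \<in> carrier R" "z \<in> carrier R"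
    by (simp_all add: uv)
  have diff: "s \<otimes> (xx \<ominus> x1) \<oplus> t \<otimes> (yy \<ominus> y1) = (s \<otimes> xx \<oplus> t \<otimes> yy \<oplus> r) \<ominus> (s \<otimes> x1 \<oplus> t \<otimes> y1 \<oplus> r)"
    if "s \<in> carrier R" "t \<in> carrier R" "r \<in> carrier R" "xx \<in> carrier R" "yy \<in> carrier R" for s t r xx yy
    using that closed by algebra
  have zero: "a \<otimes> u \<oplus> b \<otimes> v = \<zero>" "a' \<otimes> u \<oplus> b' \<otimes> v = \<zero>" "a \<otimes> w \<oplus> b \<otimes> z = \<zero>"
    unfolding uv using diff[of a b c] diff[of a' b' c'] on by simp_all
  \<comment> \<open>The determinant of the two normal vectors. Both are orthogonal to the nonzero
    direction \<open>(u, v)\<close>, so \<open>d \<otimes> u\<close> and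
    \<open>d \<otimes> v\<close> vanish as combinations of the two forms.\<close>
  define d where "d = a \<otimes> b' \<ominus> a' \<otimes> b"
  have [simp]: "d \<in> carrier R" "\<zero> \<ominus> \<zero> = \<zero>" by (simp_all add: d_def)
  have "d \<otimes> u = b' \<otimes> (a \<otimes> u \<oplus> b \<otimes> v) \<ominus> b \<otimes> (a' \<otimes> u \<oplus> b' \<otimes> v)"
    unfolding d_def using closed \<open>u \<in> carrier R\<close> \<open>v \<in> carrier R\<close> by algebra
  then have "d \<otimes> u = \<zero>" by (simp add: zero)
  moreover have "d \<otimes> v = a \<otimes> (a' \<otimes> u \<oplus> b' \<otimes> v) \<ominus> a' \<otimes> (a \<otimes> u \<oplus> b \<otimes> v)"
    unfolding d_def using closed \<open>u \<in> carrier R\<close> \<open>v \<in> carrier R\<close> by algebra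
  then have "d \<otimes> v = \<zero>" by (simp add: zero)
  moreover have "u \<noteq> \<zero> \<or> v \<noteq> \<zero>"
    using points by (auto simp: uv)
  ultimately have "d = \<zero>" by (auto simp: integral_iff)
  then have cross: "a \<otimes> b' = a' \<otimes> b" by (simp add: d_def)
  \<comment> \<open>As the normals are proportional, the second form at \<open>(w, z)\<close> is
    annihilated by both \<open>a\<close> and \<open>b\<close>, one of which is nonzero.\<close>
  have "a \<otimes> (a' \<otimes> w \<oplus> b' \<otimes> z) = a' \<otimes> (a \<otimes> w) \<oplus> (a \<otimes> b') \<otimes> z"
    using closed \<open>w \<in> carrier R\<close> \<open>z \<in> carrier R\<close> by algebra
  also have "\<dots> = a' \<otimes> (a \<otimes> w \<oplus> b \<otimes> z)"
    unfolding cross using closed \<open>w \<in> carrier R\<close> \<open>z \<in> carrier R\<close> by algebra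
  finally have "a \<otimes> (a' \<otimes> w \<oplus> b' \<otimes> z) = \<zero>" by (simp add: zero)
  moreover have "b \<otimes> (a' \<otimes> w \<oplus> b' \<otimes> z) = (a' \<otimes> b) \<otimes> w \<oplus> b' \<otimes> (b \<otimes> z)"
    using closed \<open>w \<in> carrier R\<close> \<open>z \<in> carrier R\<close> by algebra
  moreover have "(a \<otimes> b') \<otimes> w \<oplus> b' \<otimes> (b \<otimes> z) = b' \<otimes> (a \<otimes> w \<oplus> b \<otimes> z)"
    using closed \<open>w \<in> carrier R\<close> \<open>z \<in> carrier R\<close> by algebra
  ultimately have "a' \<otimes> w \<oplus> b' \<otimes> z = \<zero>"
    using coeffs(4) cross by (auto simp: zero integral_iff)
  then show ?thesis
    unfolding uv using diff[of a' b' c' x y] on(4) by simp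
qed

definition line_of :: "('a, 'm) ring_scheme \<Rightarrow> 'a \<Rightarrow> 'a \<Rightarrow> 'a \<Rightarrow> ('a \<times> 'a) set" where
  "line_of K a b c = {(x, y) \<in> plane K. a \<otimes>\<^bsub>K\<^esub> x \<oplus>\<^bsub>K\<^esub> b \<otimes>\<^bsub>K\<^esub> y \<oplus>\<^bsub>K\<^esub> c = \<zero>\<^bsub>K\<^esub>}"

lemma line_of_in_lines:
  assumes "a \<in> carrier K" "b \<in> carrier K" "c \<in> carrier K" "(a, b) \<noteq> (\<zero>\<^bsub>K\<^esub>, \<zero>\<^bsub>K\<^esub>)"
  shows "line_of K a b c \<in> lines K"
  using assms unfolding lines_def line_of_def by blast

lemma linesE:
  assumes "l \<in> lines K"
  obtains a b c where "a \<in> carrier K" "b \<in> carrier K" "c \<in> carrier K" "(a, b) \<noteq> (\<zero>\<^bsub>K\<^esub>, \<zero>\<^bsub>K\<^esub>)"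
    "l = line_of K a b c"
  using assms unfolding lines_def line_of_def by blast

lemma lines_eqI:
  fixes K (structure)
  assumes "field K" "l \<in> lines K" "l' \<in> lines K" "p \<noteq> q" "p \<in> l" "q \<in> l" "p \<in> l'" "q \<in> l'"
  shows "l = l'"
proof -
  interpret field K by fact
  have "m \<subseteq> m'" if m: "m \<in> lines K" "m' \<in> lines K" "p \<in> m" "q \<in> m" "p \<in> m'" "q \<in> m'" for m m'
  proof
    fix r assume r: "r \<in> m"
    obtain a b c where abc: "a \<in> carrier K" "b \<in> carrier K" "c \<in> carrier K" "(a, b) \<noteq> (\<zero>, \<zero>)"
      and m1: "m = line_of K a b c"
      using m(1) by (rule linesE)
    obtain a' b' c' where abc': "a' \<in> carrier K" "b' \<in> carrier K" "c' \<in> carrier K"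
      and m2: "m' = line_of K a' b' c'"
      using m(2) by (rule linesE)
    obtain x1 y1 x2 y2 x y where pts: "p = (x1, y1)" "q = (x2, y2)" "r = (x, y)" by (metis surj_pair)
    have "(x1, y1) \<in> m" "(x2, y2) \<in> m" "(x, y) \<in> m" "(x1, y1) \<in> m'" "(x2, y2) \<in> m'"
      using m r pts by simp_all
    then have "x1 \<in> carrier K" "y1 \<in> carrier K" "x2 \<in> carrier K" "y2 \<in> carrier K"
      "x \<in> carrier K" "y \<in> carrier K"
      "a \<otimes> x1 \<oplus> b \<otimes> y1 \<oplus> c = \<zero>" "a \<otimes> x2 \<oplus> b \<otimes> y2 \<oplus> c = \<zero>" "a \<otimes> x \<oplus> b \<otimes> y \<oplus> c = \<zero>"
      "a' \<otimes> x1 \<oplus> b' \<otimes> y1 \<oplus> c' = \<zero>" "a' \<otimes> x2 \<oplus> b' \<otimes> y2 \<oplus> c' = \<zero>"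
      unfolding m1 m2 line_of_def plane_def by auto
    moreover have "(x1, y1) \<noteq> (x2, y2)" using assms(4) pts by simp
    ultimately have "a' \<otimes> x \<oplus> b' \<otimes> y \<oplus> c' = \<zero>"
      using line_through_two_points[OF abc abc', of x1 y1 x2 y2 x y] by blast
    with \<open>x \<in> carrier K\<close> \<open>y \<in> carrier K\<close> show "r \<in> m'"
      unfolding m2 pts line_of_def plane_def by simp
  qed
  then show ?thesis using assms by blast
qed

lemma inj_on_spanned_lines:
  assumes "field K" "finite P"
  shows "inj_on (\<lambda>l. l \<inter> P) (spanned_lines K P)"
proof (rule inj_onI)
  fix l l' assume l: "l \<in> spanned_lines K P" "l' \<in> spanned_lines K P" "l \<inter> P = l' \<inter> P"
  then have "2 \<le> card (l \<inter> P)" by (simp add: spanned_lines_def)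
  then obtain T where "T \<subseteq> l \<inter> P" "card T = 2" using obtain_subset_with_card_n by metis
  then obtain p q where "p \<noteq> q" "{p, q} \<subseteq> l \<inter> P" by (metis card_2_iff)
  with l show "l = l'"
    using lines_eqI[OF assms(1), of l l' p q] by (auto simp: spanned_lines_def)
qed

lemma finite_spanned_lines:
  assumes "field K" "finite P"
  shows "finite (spanned_lines K P)"
  by (rule finite_imageD[OF _ inj_on_spanned_lines[OF assms]], rule finite_subset[of _ "Pow P"])
    (use assms in auto)

text \<open>Bounds the number of spanned lines from below, by traces and by lines over a copy of a
  subfield.\<close>

lemma card_le_spanned_lines:
  assumes "field K" "finite P" "inj_on h X" "\<And>t. t \<in> X \<Longrightarrow> \<exists>l\<in>spanned_lines K P. l \<inter> P = h t"
  shows "card X \<le> card (spanned_lines K P)"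
proof -
  have "h ` X \<subseteq> (\<lambda>l. l \<inter> P) ` spanned_lines K P"
  proof (rule image_subsetI)
    fix t assume "t \<in> X"
    then obtain l where "l \<in> spanned_lines K P" "l \<inter> P = h t" using assms(4) by blast
    then show "h t \<in> (\<lambda>l. l \<inter> P) ` spanned_lines K P" by (auto intro: rev_image_eqI)
  qed
  then have "card (h ` X) \<le> card (spanned_lines K P)"
    using finite_spanned_lines[OF assms(1,2)] by (rule surj_card_le[rotated])
  then show ?thesis by (simp add: card_image[OF assms(3)])
qed

section \<open>Copies of fields on the natural numbers\<close>

lemma image_ring_apply:
  assumes "inj_on f (carrier R)" "a \<in> carrier R" "b \<in> carrier R"
  shows "f a \<otimes>\<^bsub>image_ring f R\<^esub> f b = f (a \<otimes>\<^bsub>R\<^esub> b)" "f a \<oplus>\<^bsub>image_ring f R\<^esub> f b = f (a \<oplus>\<^bsub>R\<^esub> b)"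
  using assms by (simp_all add: image_ring_def image_group_def monoid.defs)

lemma char_zero_image_ring:
  assumes "field R" "char_zero R" "inj_on f (carrier R)"
  shows "char_zero (image_ring f R)"
  unfolding char_zero_def
proof (intro allI impI)
  interpret R: field R by fact
  interpret I: field "image_ring f R" by (rule R.inj_imp_image_ring_is_field[OF assms(3)])
  have "[n] \<cdot>\<^bsub>image_ring f R\<^esub> \<one>\<^bsub>image_ring f R\<^esub> = f ([n] \<cdot>\<^bsub>R\<^esub> \<one>\<^bsub>R\<^esub>)" for n :: nat
    by (induction n)
      (simp_all add: image_ring_zero image_ring_one image_ring_apply[OF assms(3)])
  moreover fix n :: nat assume "0 < n"
  ultimately show "[n] \<cdot>\<^bsub>image_ring f R\<^esub> \<one>\<^bsub>image_ring f R\<^esub> \<noteq> \<zero>\<^bsub>image_ring f R\<^esub>"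
    using assms(2,3) unfolding char_zero_def image_ring_zero
    by (metis R.add.nat_pow_closed R.one_closed R.zero_closed inj_on_eq_iff)
qed

text \<open>Serves to show that some field of characteristic 0 has its carrier in
  \<open>nat\<close>, so that the choice of \<open>critical_ring\<close> succeeds.\<close>

definition rat_ring :: "rat ring" where
  "rat_ring = \<lparr>carrier = UNIV, monoid.mult = times, one = 1, ring.zero = 0, add = plus\<rparr>"

lemma rat_ring_simps:
  "carrier rat_ring = UNIV" "\<one>\<^bsub>rat_ring\<^esub> = 1" "\<zero>\<^bsub>rat_ring\<^esub> = 0"
  "x \<otimes>\<^bsub>rat_ring\<^esub> y = x * y" "x \<oplus>\<^bsub>rat_ring\<^esub> y = x + y"
  by (simp_all add: rat_ring_def)

lemma field_rat_ring: "field rat_ring"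
proof (rule cring.cring_fieldI2)
  show "cring rat_ring"
    by (rule cringI, rule abelian_groupI, unfold rat_ring_def)
      (auto intro!: comm_monoidI exI[of _ "- x" for x] simp: algebra_simps)
  show "\<zero>\<^bsub>rat_ring\<^esub> \<noteq> \<one>\<^bsub>rat_ring\<^esub>" by (simp add: rat_ring_def)
  show "\<exists>b\<in>carrier rat_ring. a \<otimes>\<^bsub>rat_ring\<^esub> b = \<one>\<^bsub>rat_ring\<^esub>" if "a \<noteq> \<zero>\<^bsub>rat_ring\<^esub>" for a
    using that by (intro bexI[of _ "inverse a"]) (simp_all add: rat_ring_def)
qed

lemma char_zero_rat_ring: "char_zero rat_ring"
proof -
  interpret field rat_ring by (rule field_rat_ring)
  have "[n] \<cdot>\<^bsub>rat_ring\<^esub> \<one>\<^bsub>rat_ring\<^esub> = of_nat n" for n :: nat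
    by (induction n) (simp_all add: rat_ring_simps)
  then show ?thesis by (simp add: char_zero_def rat_ring_simps)
qed

lemma nat_field_exists: "\<exists>K :: nat ring. field K \<and> char_zero K"
proof -
  interpret field rat_ring by (rule field_rat_ring)
  have "inj_on (to_nat :: rat \<Rightarrow> nat) (carrier rat_ring)" by simp
  then show ?thesis
    using inj_imp_image_ring_is_field char_zero_image_ring[OF field_rat_ring char_zero_rat_ring] by blast
qed

text \<open>A field given as a record is not a type of class \<^class>\<open>field_char_0\<close>, and a local \<open>K\<close> cannot be made
  one. The closed term below can: it denotes a counterexample to the bound, if there is one among the
  fields of characteristic 0 with carrier in \<^typ>\<open>nat\<close>. Proving the bound for the type
  cut out by this single ring therefore proves it for all of them.\<close>

definition critical_ring :: "nat ring" where
  "critical_ring = (SOME K. field K \<and> char_zero K \<and>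
     ((\<exists>K' :: nat ring. field K' \<and> char_zero K' \<and> \<not> beck_for_field (1 / 10 ^ 7) K') \<longrightarrow>
       \<not> beck_for_field (1 / 10 ^ 7) K))"

lemma critical_ring:
  "field critical_ring" "char_zero critical_ring"
  "beck_for_field (1 / 10 ^ 7) critical_ring \<Longrightarrow> field (K :: nat ring) \<Longrightarrow> char_zero K \<Longrightarrow>
    beck_for_field (1 / 10 ^ 7) K"
proof -
  let ?P = "\<lambda>K :: nat ring. field K \<and> char_zero K \<and>
     ((\<exists>K' :: nat ring. field K' \<and> char_zero K' \<and> \<not> beck_for_field (1 / 10 ^ 7) K') \<longrightarrow>
       \<not> beck_for_field (1 / 10 ^ 7) K)"
  \<comment> \<open>A counterexample if there is one, otherwise any field of characteristic
    0.\<close>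
  have "\<exists>K. ?P K" using nat_field_exists by blast
  then have "?P critical_ring" unfolding critical_ring_def by (rule someI_ex)
  then show "field critical_ring" "char_zero critical_ring"
    "beck_for_field (1 / 10 ^ 7) critical_ring \<Longrightarrow> field (K :: nat ring) \<Longrightarrow> char_zero K \<Longrightarrow>
      beck_for_field (1 / 10 ^ 7) K" by blast+
qed

section \<open>The critical field as a type\<close>

typedef critical = "carrier critical_ring"
  using ring.ring_simprules(2)[OF field.is_ring[OF critical_ring(1)]] by blast

instantiation critical :: field
begin

definition "0 = Abs_critical \<zero>\<^bsub>critical_ring\<^esub>"
definition "1 = Abs_critical \<one>\<^bsub>critical_ring\<^esub>"
definition "x + y = Abs_critical (Rep_critical x \<oplus>\<^bsub>critical_ring\<^esub> Rep_critical y)"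
definition "- x = Abs_critical (\<ominus>\<^bsub>critical_ring\<^esub> Rep_critical x)"
definition "x - y = x + - (y :: critical)"
definition "x * y = Abs_critical (Rep_critical x \<otimes>\<^bsub>critical_ring\<^esub> Rep_critical y)"
text \<open>The class requires \<open>inverse 0 = 0\<close>, a value that \<open>inv\<close> does
  not provide.\<close>

definition "inverse x = (if x = 0 then 0 else Abs_critical (inv\<^bsub>critical_ring\<^esub> Rep_critical x))"
definition "x div y = x * inverse (y :: critical)"

lemma Rep_critical_closed [simp]: "Rep_critical x \<in> carrier critical_ring"
  by (rule Rep_critical)

lemma Rep_critical_0: "Rep_critical 0 = \<zero>\<^bsub>critical_ring\<^esub>"
  and Rep_critical_1: "Rep_critical 1 = \<one>\<^bsub>critical_ring\<^esub>"
  and Rep_critical_add: "Rep_critical (x + y) = Rep_critical x \<oplus>\<^bsub>critical_ring\<^esub> Rep_critical y"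
  and Rep_critical_uminus: "Rep_critical (- x) = \<ominus>\<^bsub>critical_ring\<^esub> Rep_critical x"
  and Rep_critical_mult: "Rep_critical (x * y) = Rep_critical x \<otimes>\<^bsub>critical_ring\<^esub> Rep_critical y"
proof -
  interpret C: field critical_ring by (rule critical_ring(1))
  show "Rep_critical 0 = \<zero>\<^bsub>critical_ring\<^esub>"
    "Rep_critical 1 = \<one>\<^bsub>critical_ring\<^esub>"
    "Rep_critical (x + y) = Rep_critical x \<oplus>\<^bsub>critical_ring\<^esub> Rep_critical y"
    "Rep_critical (- x) = \<ominus>\<^bsub>critical_ring\<^esub> Rep_critical x"
    "Rep_critical (x * y) = Rep_critical x \<otimes>\<^bsub>critical_ring\<^esub> Rep_critical y"
    by (simp_all add: zero_critical_def one_critical_def plus_critical_def uminus_critical_def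
        times_critical_def Abs_critical_inverse)
qed

lemmas Rep_critical_hom = Rep_critical_0 Rep_critical_1 Rep_critical_add Rep_critical_uminus Rep_critical_mult

instance
proof
  interpret C: field critical_ring by (rule critical_ring(1))
  fix a b c :: critical
  note [simp] = Rep_critical_inject[symmetric] Rep_critical_hom minus_critical_def
  show "a * b * c = a * (b * c)" by (simp add: C.m_assoc)
  show "a * b = b * a" by (simp add: C.m_comm)
  show "1 * a = a" by simp
  show "a + b + c = a + (b + c)" by (simp add: C.a_assoc)
  show "a + b = b + a" by (simp add: C.a_comm)
  show "0 + a = a" by simp
  show "- a + a = 0" by (simp add: C.l_neg)
  show "a - b = a + - b" by simp
  show "(a + b) * c = a * c + b * c" by (simp add: C.l_distr)
  show "(0 :: critical) \<noteq> 1" by simp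
  show "inverse (0 :: critical) = 0" by (simp add: inverse_critical_def)
  show "a div b = a * inverse b" by (simp add: divide_critical_def)
  show "inverse a * a = 1" if "a \<noteq> 0"
  proof -
    have "Rep_critical a \<in> Units critical_ring"
      using that by (simp add: C.field_Units)
    then have "Rep_critical (inverse a) = inv\<^bsub>critical_ring\<^esub> Rep_critical a"
      using that by (simp add: inverse_critical_def Abs_critical_inverse del: Rep_critical_inject[symmetric])
    then show ?thesis using \<open>Rep_critical a \<in> Units critical_ring\<close> by simp
  qed
qed

end

instance critical :: field_char_0
proof
  interpret C: field critical_ring by (rule critical_ring(1))
  have of_nat: "Rep_critical (of_nat n) = [n] \<cdot>\<^bsub>critical_ring\<^esub> \<one>\<^bsub>critical_ring\<^esub>" for n
    by (induction n) (simp_all add: Rep_critical_hom C.a_comm)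
  have nz: "(of_nat n :: critical) \<noteq> 0" if "n > 0" for n
  proof
    assume "(of_nat n :: critical) = 0"
    with of_nat[of n] have "[n] \<cdot>\<^bsub>critical_ring\<^esub> \<one>\<^bsub>critical_ring\<^esub> = \<zero>\<^bsub>critical_ring\<^esub>"
      by (simp only: Rep_critical_0)
    with critical_ring(2) that show False unfolding char_zero_def by blast
  qed
  show "inj (of_nat :: nat \<Rightarrow> critical)"
  proof (rule linorder_injI)
    fix m n :: nat assume "m < n"
    then have "(of_nat (n - m) :: critical) = of_nat n - of_nat m" "0 < n - m"
      by (simp_all add: of_nat_diff)
    with nz show "(of_nat m :: critical) \<noteq> of_nat n" by (metis diff_self)
  qed
qed

text \<open>Brings \<open>beck_char_0\<close> back from the type: \<open>Rep_critical\<close> on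
  coordinates turns each trace into the intersection of \<open>P\<close> with a spanned
  line.\<close>

lemma beck_critical_ring: "beck_for_field (1 / 10 ^ 7) critical_ring"
  unfolding beck_for_field_def
proof (intro allI impI)
  fix P assume P: "finite P" "P \<subseteq> plane critical_ring" "card P \<noteq> 1"
  define h where "h = map_prod Rep_critical Rep_critical"
  have inj: "inj h"
    unfolding h_def by (intro prod.inj_map) (simp_all add: inj_def Rep_critical_inject)
  define Q where "Q = h -` P"
  have "range Rep_critical = carrier critical_ring"
    by (rule type_definition.Rep_range[OF type_definition_critical])
  then have "plane critical_ring = range h"
    unfolding h_def plane_def by (metis UNIV_Times_UNIV map_prod_surj_on)
  then have PQ: "P = h ` Q" using P(2) by (auto simp: Q_def)
  have inj_on: "inj_on h X" for X using inj inj_on_subset by blast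
  have "finite Q" unfolding Q_def by (rule finite_vimageI[OF P(1) inj])
  moreover have "card P = card Q" unfolding PQ by (rule card_image[OF inj_on])
  ultimately have Q: "finite Q" "card Q = card P" by simp_all
  have trace: "\<exists>l\<in>spanned_lines critical_ring P. l \<inter> P = h ` t" if t: "t \<in> traces Q" for t
  proof -
    obtain p q where pq: "p \<in> Q" "q \<in> Q" "p \<noteq> q" "t = line_trace Q p q" using t by (auto simp: traces_def)
    \<comment> \<open>Expanding the cross product in \<open>aligned p q r\<close> gives a linear
      equation in \<open>r\<close> with these coefficients.\<close>
    define a b c where "a = - (snd q - snd p)" "b = fst q - fst p" "c = - (a * fst p + b * snd p)"
    have ali: "aligned p q r \<longleftrightarrow> a * fst r + b * snd r + c = 0" for r
      by (auto simp: aligned_def a_b_c_def algebra_simps)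
    have "(a, b) \<noteq> (0, 0)" using pq(3) by (auto simp: a_b_c_def prod_eq_iff)
    define l where "l = line_of critical_ring (Rep_critical a) (Rep_critical b) (Rep_critical c)"
    have "l \<in> lines critical_ring"
      using \<open>(a, b) \<noteq> (0, 0)\<close> unfolding l_def
      by (intro line_of_in_lines) (auto simp: Rep_critical_inject simp flip: Rep_critical_0)
    have mem: "h r \<in> l \<longleftrightarrow> aligned p q r" for r
      unfolding ali l_def h_def line_of_def
      by (cases r) (simp add: plane_def Rep_critical_inject flip: Rep_critical_hom)
    then have eq: "l \<inter> P = h ` t"
      unfolding PQ pq(4) line_trace_def by auto
    have "card {p, q} \<le> card t"
      using Q(1) pq by (intro card_mono) (auto simp: line_trace_def)
    then have "2 \<le> card (l \<inter> P)"
      using pq(3) unfolding eq card_image[OF inj_on] by simp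
    with \<open>l \<in> lines critical_ring\<close> eq show ?thesis by (auto simp: spanned_lines_def)
  qed
  have "beck_property Q" using P(3) Q by (intro beck_char_0) auto
  then consider t where "t \<in> traces Q" "card Q \<le> 10 ^ 7 * card t" | "(card Q)\<^sup>2 \<le> 10 ^ 7 * card (traces Q)"
    by (auto simp: beck_property_def)
  then show "beck_dichotomy (1 / 10 ^ 7) critical_ring P"
  proof cases
    case 1
    obtain l where l: "l \<in> spanned_lines critical_ring P" "l \<inter> P = h ` t" using trace[OF 1(1)] by blast
    have "card (l \<inter> P) = card t" unfolding l(2) by (rule card_image[OF inj_on])
    with 1(2) Q(2) have "real (card P) \<le> real (10 ^ 7 * card (l \<inter> P))" by (simp only: of_nat_le_iff)
    with l(1) show ?thesis
      unfolding beck_dichotomy_def by (intro disjI1 bexI[of _ l]) simp_all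
  next
    case 2
    have "inj_on ((`) h) (traces Q)" using inj by (auto intro: inj_onI simp: inj_image_eq_iff)
    then have "card (traces Q) \<le> card (spanned_lines critical_ring P)"
      by (rule card_le_spanned_lines[OF critical_ring(1) P(1) _ trace])
    then have "10 ^ 7 * card (traces Q) \<le> 10 ^ 7 * card (spanned_lines critical_ring P)"
      by (rule mult_left_mono) simp
    with 2 have "(card P)\<^sup>2 \<le> 10 ^ 7 * card (spanned_lines critical_ring P)"
      unfolding Q(2) by (rule order.trans)
    then have "real ((card P)\<^sup>2) \<le> real (10 ^ 7 * card (spanned_lines critical_ring P))" by (simp only: of_nat_le_iff)
    then show ?thesis unfolding beck_dichotomy_def by (intro disjI2) simp
  qed
qed

text \<open>The witness \<open>1 / 10^7\<close> shows that the choice defining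
  \<open>beck_constant\<close> succeeds.\<close>

lemma beck_constant:
  "0 < beck_constant" "field (K :: nat ring) \<Longrightarrow> char_zero K \<Longrightarrow> beck_for_field beck_constant K"
proof -
  have "\<exists>c. 0 < c \<and> (\<forall>K :: nat ring. field K \<longrightarrow> char_zero K \<longrightarrow> beck_for_field c K)"
    using critical_ring(3)[OF beck_critical_ring] by (intro exI[of _ "1 / 10 ^ 7"]) simp
  from someI_ex[OF this] show "0 < beck_constant"
    "field (K :: nat ring) \<Longrightarrow> char_zero K \<Longrightarrow> beck_for_field beck_constant K"
    unfolding beck_constant_def by blast+
qed

section \<open>Passage to a countable subfield\<close>

datatype field_term =
  Gen nat | One | Neg field_term | Inv field_term | Add field_term field_term | Mult field_term field_term

instance field_term :: countable
  by countable_datatype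

primrec field_term_value :: "('a, 'm) ring_scheme \<Rightarrow> (nat \<Rightarrow> 'a) \<Rightarrow> field_term \<Rightarrow> 'a" where
  "field_term_value K g (Gen n) = g n"
| "field_term_value K g One = \<one>\<^bsub>K\<^esub>"
| "field_term_value K g (Neg s) = \<ominus>\<^bsub>K\<^esub> field_term_value K g s"
| "field_term_value K g (Inv s) = inv\<^bsub>K\<^esub> field_term_value K g s"
| "field_term_value K g (Add s t) = field_term_value K g s \<oplus>\<^bsub>K\<^esub> field_term_value K g t"
| "field_term_value K g (Mult s t) = field_term_value K g s \<otimes>\<^bsub>K\<^esub> field_term_value K g t"

text \<open>Every element is the value of a term in the field operations, with \<open>Gen n\<close>
  naming the \<open>n\<close>-th generator, and there are only countably many terms.\<close>

lemma countable_generate_field: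
  assumes "countable S"
  shows "countable (generate_field K S)"
proof -
  let ?v = "field_term_value K (from_nat_into S)"
  have "x \<in> range ?v" if "x \<in> generate_field K S" for x
    using that
  proof induction
    case one
    show ?case by (rule range_eqI[of _ _ One]) simp
  next
    case (incl h)
    then obtain n where "from_nat_into S n = h" using from_nat_into_surj[OF assms] by blast
    then show ?case by (intro range_eqI[of _ _ "Gen n"]) simp
  next
    case (a_inv h)
    then obtain s where "h = ?v s" by blast
    then show ?case by (intro range_eqI[of _ _ "Neg s"]) simp
  next
    case (m_inv h)
    then obtain s where "h = ?v s" by blast
    then show ?case by (intro range_eqI[of _ _ "Inv s"]) simp
  next
    case (eng_add h1 h2)
    then obtain s t where "h1 = ?v s" "h2 = ?v t" by blast
    then show ?case by (intro range_eqI[of _ _ "Add s t"]) simp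
  next
    case (eng_mult h1 h2)
    then obtain s t where "h1 = ?v s" "h2 = ?v t" by blast
    then show ?case by (intro range_eqI[of _ _ "Mult s t"]) simp
  qed
  then have "generate_field K S \<subseteq> range ?v" by blast
  then show ?thesis by (rule countable_subset) simp
qed

text \<open>The subfield generated by the coordinates of \<open>P\<close> is countable, so it has a
  copy \<open>N\<close> with carrier in \<open>nat\<close>, to which \<open>beck_constant\<close>
  applies.\<close>

lemma beck_for_every_field:
  fixes K :: "('a, 'm) ring_scheme"
  assumes K: "field K" "char_zero K"
  shows "beck_for_field beck_constant K"
  unfolding beck_for_field_def
proof (intro allI impI)
  fix P assume P: "finite P" "P \<subseteq> plane K" "card P \<noteq> 1"
  interpret K: field K by (rule K(1))
  define k where "k = generate_field K (fst ` P \<union> snd ` P)"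
  have coords: "fst ` P \<union> snd ` P \<subseteq> carrier K" using P(2) by (auto simp: plane_def)
  have "countable k"
    unfolding k_def using P(1) by (intro countable_generate_field countable_finite) simp
  have "k \<subseteq> carrier K" unfolding k_def by (rule K.generate_field_incl[OF coords])
  define F where "F = K\<lparr>carrier := k\<rparr>"
  have "field F" unfolding F_def k_def by (rule K.generate_field_is_field[OF coords])
  then interpret F: field F .
  have F_simps: "carrier F = k" "\<one>\<^bsub>F\<^esub> = \<one>\<^bsub>K\<^esub>" "\<zero>\<^bsub>F\<^esub> = \<zero>\<^bsub>K\<^esub>"
    "x \<oplus>\<^bsub>F\<^esub> y = x \<oplus>\<^bsub>K\<^esub> y" "x \<otimes>\<^bsub>F\<^esub> y = x \<otimes>\<^bsub>K\<^esub> y" for x y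
    by (simp_all add: F_def)
  have "[n] \<cdot>\<^bsub>F\<^esub> \<one>\<^bsub>F\<^esub> = [n] \<cdot>\<^bsub>K\<^esub> \<one>\<^bsub>K\<^esub>" for n :: nat
    by (induction n) (simp_all add: F_simps)
  then have "char_zero F" using K(2) by (simp add: char_zero_def F_simps)
  define f where "f = to_nat_on k"
  have inj: "inj_on f (carrier F)"
    unfolding f_def F_simps by (rule inj_on_to_nat_on[OF \<open>countable k\<close>])
  define N where "N = image_ring f F"
  have N: "field N" "char_zero N"
    unfolding N_def using F.inj_imp_image_ring_is_field[OF inj] char_zero_image_ring[OF \<open>field F\<close> \<open>char_zero F\<close> inj]
    by auto
  define h where "h = map_prod f f"
  have Pk: "fst p \<in> k" "snd p \<in> k" if "p \<in> P" for p
    using that unfolding k_def by (auto intro!: generate_field.incl)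
  have inj_h: "inj_on h P"
    using inj_onD[OF inj] Pk unfolding F_simps h_def by (intro inj_onI prod_eqI) (auto simp: map_prod_def case_prod_beta)
  have Q: "finite (h ` P)" "card (h ` P) = card P" "h ` P \<subseteq> plane N"
    using P(1) card_image[OF inj_h] Pk
    by (auto simp: plane_def N_def image_ring_carrier F_simps h_def map_prod_def case_prod_beta)
  \<comment> \<open>Both alternatives are lower bounds, so it is enough to bring lines over
    \<open>N\<close> back: the same coefficients, read in \<open>K\<close>, give a line with the
    same points of \<open>P\<close>.\<close>
  have line: "\<exists>l\<in>spanned_lines K P. l \<inter> P = {p \<in> P. h p \<in> t}" if t: "t \<in> spanned_lines N (h ` P)" for t
  proof -
    have "t \<in> lines N" using t by (simp add: spanned_lines_def)
    then obtain a' b' c' where abc': "a' \<in> carrier N" "b' \<in> carrier N" "c' \<in> carrier N" "(a', b') \<noteq> (\<zero>\<^bsub>N\<^esub>, \<zero>\<^bsub>N\<^esub>)"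
      and t': "t = line_of N a' b' c'" by (rule linesE)
    then obtain a b c where abc: "a \<in> k" "b \<in> k" "c \<in> k" "a' = f a" "b' = f b" "c' = f c"
      unfolding N_def image_ring_carrier F_simps by blast
    define l where "l = line_of K a b c"
    have "(a, b) \<noteq> (\<zero>\<^bsub>K\<^esub>, \<zero>\<^bsub>K\<^esub>)"
      using abc'(4) abc(4,5) by (auto simp: N_def image_ring_zero F_simps)
    then have "l \<in> lines K"
      unfolding l_def using abc(1-3) \<open>k \<subseteq> carrier K\<close> by (intro line_of_in_lines) auto
    have mem: "p \<in> l \<longleftrightarrow> h p \<in> t" if p: "p \<in> P" for p
    proof -
      have pt: "p \<in> plane K" "h p \<in> plane N" using p P(2) Q(3) by auto
      have closed: "a \<in> carrier F" "b \<in> carrier F" "c \<in> carrier F" "fst p \<in> carrier F" "snd p \<in> carrier F"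
        using abc(1-3) Pk[OF p] by (simp_all add: F_simps)
      have "h p \<in> t \<longleftrightarrow> f (a \<otimes>\<^bsub>F\<^esub> fst p \<oplus>\<^bsub>F\<^esub> b \<otimes>\<^bsub>F\<^esub> snd p \<oplus>\<^bsub>F\<^esub> c) = f \<zero>\<^bsub>F\<^esub>"
        using pt(2) closed unfolding t' line_of_def abc h_def N_def
        by (cases p) (simp add: image_ring_apply[OF inj] image_ring_zero)
      also have "\<dots> \<longleftrightarrow> a \<otimes>\<^bsub>F\<^esub> fst p \<oplus>\<^bsub>F\<^esub> b \<otimes>\<^bsub>F\<^esub> snd p \<oplus>\<^bsub>F\<^esub> c = \<zero>\<^bsub>F\<^esub>"
        using closed by (intro inj_on_eq_iff[OF inj]) auto
      also have "\<dots> \<longleftrightarrow> p \<in> l"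
        using pt(1) unfolding l_def line_of_def by (cases p) (simp add: F_simps)
      finally show ?thesis by simp
    qed
    then have eq: "l \<inter> P = {p \<in> P. h p \<in> t}" by blast
    then have "h ` (l \<inter> P) = t \<inter> h ` P" by blast
    then have "card (l \<inter> P) = card (t \<inter> h ` P)"
      using card_image[OF inj_on_subset[OF inj_h, of "l \<inter> P"]] by simp
    then have "l \<in> spanned_lines K P"
      using t \<open>l \<in> lines K\<close> by (simp add: spanned_lines_def)
    with eq show ?thesis by blast
  qed
  have "beck_dichotomy beck_constant N (h ` P)"
    using beck_constant(2)[OF N] Q P(3) unfolding beck_for_field_def by simp
  then show "beck_dichotomy beck_constant K P"
    unfolding beck_dichotomy_def Q(2)
  proof
    assume "\<exists>t\<in>spanned_lines N (h ` P). beck_constant * real (card P) \<le> real (card (t \<inter> h ` P))"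
    then obtain t where t: "t \<in> spanned_lines N (h ` P)" "beck_constant * real (card P) \<le> real (card (t \<inter> h ` P))"
      by blast
    obtain l where l: "l \<in> spanned_lines K P" "l \<inter> P = {p \<in> P. h p \<in> t}" using line[OF t(1)] by blast
    have "t \<inter> h ` P = h ` (l \<inter> P)" unfolding l(2) by blast
    then have "card (t \<inter> h ` P) = card (l \<inter> P)"
      using card_image[OF inj_on_subset[OF inj_h, of "l \<inter> P"]] by simp
    with t l(1) show "(\<exists>l\<in>spanned_lines K P. beck_constant * real (card P) \<le> real (card (l \<inter> P))) \<or>
        beck_constant * (real (card P))\<^sup>2 \<le> real (card (spanned_lines K P))"
      by (intro disjI1 bexI[of _ l]) simp_all
  next
    assume many: "beck_constant * (real (card P))\<^sup>2 \<le> real (card (spanned_lines N (h ` P)))"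
    have "inj_on (\<lambda>t. {p \<in> P. h p \<in> t}) (spanned_lines N (h ` P))"
    proof (rule inj_onI)
      fix s t assume st: "s \<in> spanned_lines N (h ` P)" "t \<in> spanned_lines N (h ` P)"
        "{p \<in> P. h p \<in> s} = {p \<in> P. h p \<in> t}"
      from st(3) have "s \<inter> h ` P = t \<inter> h ` P" by blast
      then show "s = t" using inj_onD[OF inj_on_spanned_lines[OF N(1) Q(1)]] st(1,2) by blast
    qed
    then have "card (spanned_lines N (h ` P)) \<le> card (spanned_lines K P)"
      by (rule card_le_spanned_lines[OF K(1) P(1) _ line])
    with many show "(\<exists>l\<in>spanned_lines K P. beck_constant * real (card P) \<le> real (card (l \<inter> P))) \<or>
        beck_constant * (real (card P))\<^sup>2 \<le> real (card (spanned_lines K P))"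
      by (intro disjI2) linarith
  qed
qed

theorem theorem1p4:
  shows "0 < beck_constant \<and>
    (\<forall>K :: ('a, 'm) ring_scheme. field K \<longrightarrow> char_zero K \<longrightarrow>
      (\<forall>P. finite P \<longrightarrow> P \<subseteq> plane K \<longrightarrow> card P \<noteq> 1 \<longrightarrow>
        (\<exists>l\<in>spanned_lines K P. real (card (l \<inter> P)) \<ge> beck_constant * real (card P)) \<or>
        real (card (spanned_lines K P)) \<ge> beck_constant * (real (card P))\<^sup>2))"
  using beck_constant(1) beck_for_every_field unfolding beck_for_field_def beck_dichotomy_def by blast

end
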